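(* Let $G$ be a locally compact Hausdorff group with left Haar measure $\mu$ and let $1\leqslant p<\infty$. If $\mathcal{F}\subset L^p(G)$ is $L^p$-equicontinuous, then for every $\varepsilon>0$ there exists a function $\phi\in C_c(G)$ such that $$\|f\star\phi-f\|_p\leqslant\varepsilon\quad\text{for all } f\in\mathcal{F}.$$
   Context: $\mu$ is a left Haar measure on $G$: a nonzero left-invariant Borel measure, finite on compact sets, inner regular on open sets and outer regular on measurable sets; $dy$ denotes integration with respect to $\mu$. $L^p(G)=L^p(G,\mu)$ (complex-valued functions) with norm $\|\cdot\|_p$. For $x\in G$, $L_xf(y):=f(xy)$ and $R_xf(y):=f(yx)$. A family $\mathcal{F}\subset L^p(G)$ is $L^p$-equicontinuous if for every $\varepsilon>0$ there exists an open neighbourhood $U_e$ of the neutral element $e$ such that for all $f\in\mathcal{F}$: $\sup_{x\in U_e}\|L_xf-f\|_p\leqslant\varepsilon$ and $\sup_{x\in U_e}\|R_xf-f\|_p\leqslant\varepsilon$. $C_c(G)$ is the space of continuous complex-valued functions with compact support. Convolution: $f\star\phi(x)=\int_G f(y)\,\phi(y^{-1}x)\,dy$ for $x\in G$. *)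

theory Defs
  imports "HOL-Analysis.Analysis"
begin

text \<open>
  Groups are rendered by the type class \<^class>\<open>topological_group_add\<close>, which is not commutative:
  the product \<open>x y\<close> is written \<open>x + y\<close>, the inverse of \<open>x\<close> is \<open>- x\<close>, the neutral element is \<open>0\<close>,
  and the order of the summands matters everywhere below.
\<close>

definition left_haar_measure :: "'a::{topological_group_add, t2_space} measure \<Rightarrow> bool" where
  "left_haar_measure \<mu> \<longleftrightarrow>
     sets \<mu> = sets borel \<and>
     emeasure \<mu> UNIV \<noteq> 0 \<and>
     (\<forall>a. \<forall>A\<in>sets borel. emeasure \<mu> ((\<lambda>y. a + y) ` A) = emeasure \<mu> A) \<and>
     (\<forall>K. compact K \<longrightarrow> emeasure \<mu> K < \<infinity>) \<and>
     (\<forall>U. open U \<longrightarrow> emeasure \<mu> U = (SUP K\<in>{K. compact K \<and> K \<subseteq> U}. emeasure \<mu> K)) \<and>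
     (\<forall>A\<in>sets borel. emeasure \<mu> A = (INF U\<in>{U. open U \<and> A \<subseteq> U}. emeasure \<mu> U))"

text \<open>
  The norm is extended-valued, so that a bound on it is never met by a default value.
  Elements of \<open>L\<^sup>p\<close> are represented by functions; two functions agreeing almost everywhere
  are not identified.
\<close>

definition Lp_norm :: "'a measure \<Rightarrow> real \<Rightarrow> ('a \<Rightarrow> complex) \<Rightarrow> ennreal" where
  "Lp_norm \<mu> p f =
     (let I = (\<integral>\<^sup>+ x. ennreal (cmod (f x) powr p) \<partial>\<mu>)
      in if I = \<infinity> then \<infinity> else ennreal (enn2real I powr (1 / p)))"

definition Lp_space :: "'a measure \<Rightarrow> real \<Rightarrow> ('a \<Rightarrow> complex) set" where
  "Lp_space \<mu> p = {f \<in> borel_measurable \<mu>. Lp_norm \<mu> p f < \<infinity>}"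

definition left_translate :: "'a::plus \<Rightarrow> ('a \<Rightarrow> complex) \<Rightarrow> 'a \<Rightarrow> complex" where
  "left_translate x f = (\<lambda>y. f (x + y))"

definition right_translate :: "'a::plus \<Rightarrow> ('a \<Rightarrow> complex) \<Rightarrow> 'a \<Rightarrow> complex" where
  "right_translate x f = (\<lambda>y. f (y + x))"

definition Lp_equicontinuous ::
    "'a::topological_group_add measure \<Rightarrow> real \<Rightarrow> ('a \<Rightarrow> complex) set \<Rightarrow> bool" where
  "Lp_equicontinuous \<mu> p F \<longleftrightarrow>
     (\<forall>\<epsilon>::real. \<epsilon> > 0 \<longrightarrow> (\<exists>U. open U \<and> 0 \<in> U \<and>
        (\<forall>f\<in>F. (SUP x\<in>U. Lp_norm \<mu> p (\<lambda>y. left_translate x f y - f y)) \<le> ennreal \<epsilon> \<and>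
               (SUP x\<in>U. Lp_norm \<mu> p (\<lambda>y. right_translate x f y - f y)) \<le> ennreal \<epsilon>)))"

definition Cc :: "('a::topological_space \<Rightarrow> complex) set" where
  "Cc = {\<phi>. continuous_on UNIV \<phi> \<and> compact (closure {x. \<phi> x \<noteq> 0})}"

definition convolve ::
    "'a::group_add measure \<Rightarrow> ('a \<Rightarrow> complex) \<Rightarrow> ('a \<Rightarrow> complex) \<Rightarrow> 'a \<Rightarrow> complex" where
  "convolve \<mu> f \<phi> = (\<lambda>x. \<integral>y. f y * \<phi> (- y + x) \<partial>\<mu>)"

text \<open>
  The Bochner integral of a non-integrable function is \<open>0\<close>; this default is never
  used when \<open>f\<close> lies in \<open>L\<^sup>p\<close> and \<open>\<phi>\<close> in \<open>C\<^sub>c\<close>.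
\<close>

lemma integrable_convolve_integrand:
  fixes \<mu> :: "'a::{topological_group_add, t2_space} measure"
  assumes \<mu>: "left_haar_measure \<mu>" and p: "1 \<le> p"
    and f: "f \<in> Lp_space \<mu> p" and \<phi>: "\<phi> \<in> Cc"
  shows "integrable \<mu> (\<lambda>y. f y * \<phi> (- y + x))"
proof -
  define S where "S = closure {x. \<phi> x \<noteq> 0}"
  define K where "K = (\<lambda>k. x + - k) ` S"
  have sets: "sets \<mu> = sets borel"
    and fin: "\<And>K. compact K \<Longrightarrow> emeasure \<mu> K < \<infinity>"
    using \<mu> by (auto simp: left_haar_measure_def)
  have S: "compact S" and cont: "continuous_on UNIV \<phi>"
    using \<phi> by (auto simp: Cc_def S_def)
  have K: "compact K"
    unfolding K_def by (intro compact_continuous_image continuous_intros S)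
  have "compact (\<phi> ` S)"
    using S cont by (meson compact_continuous_image continuous_on_subset top_greatest)
  then obtain B where B: "\<And>k. k \<in> S \<Longrightarrow> cmod (\<phi> k) \<le> B" and "B > 0"
    by (metis bounded_pos compact_imp_bounded imageI)
  have fm [measurable]: "f \<in> borel_measurable \<mu>"
    using f by (auto simp: Lp_space_def)
  have "(\<integral>\<^sup>+ x. ennreal (cmod (f x) powr p) \<partial>\<mu>) < \<infinity>"
    using f by (auto simp: Lp_space_def Lp_norm_def Let_def top.not_eq_extremum split: if_splits)
  then have fp: "integrable \<mu> (\<lambda>y. cmod (f y) powr p)"
    by (intro integrableI_nonneg) auto
  have Km: "K \<in> sets \<mu>"
    using K sets by (simp add: borel_closed compact_imp_closed)
  have Ki: "integrable \<mu> (indicator K :: 'a \<Rightarrow> real)"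
    using K Km fin by (intro integrable_real_indicator) auto
  have "continuous_on UNIV (\<lambda>y. \<phi> (- y + x))"
    by (intro continuous_on_compose2[OF cont] continuous_intros) auto
  then have "(\<lambda>y. \<phi> (- y + x)) \<in> borel_measurable borel"
    by (rule borel_measurable_continuous_onI)
  then have \<phi>m [measurable]: "(\<lambda>y. \<phi> (- y + x)) \<in> borel_measurable \<mu>"
    using sets by (simp cong: measurable_cong_sets)
  have le: "cmod (f y * \<phi> (- y + x)) \<le> B * (indicator K y + cmod (f y) powr p)" for y
  proof (cases "\<phi> (- y + x) = 0")
    case True
    then show ?thesis using \<open>B > 0\<close> by simp
  next
    case False
    then have k: "- y + x \<in> S"
      using closure_subset[of "{x. \<phi> x \<noteq> 0}"] by (auto simp: S_def)
    have "y = x + - (- y + x)"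
      by (simp only: minus_add minus_minus add_minus_cancel)
    then have "y \<in> K" unfolding K_def using k by blast
    have "cmod (f y) \<le> 1 + cmod (f y) powr p"
    proof (cases "cmod (f y) \<le> 1")
      case True
      then show ?thesis by (smt (verit) powr_ge_zero)
    next
      case False
      then have "cmod (f y) powr 1 \<le> cmod (f y) powr p"
        using p by (intro powr_mono) auto
      then show ?thesis using False by simp
    qed
    then have "cmod (f y) * cmod (\<phi> (- y + x)) \<le> (1 + cmod (f y) powr p) * B"
      using B[OF k] by (intro mult_mono) auto
    then show ?thesis using \<open>y \<in> K\<close> by (simp add: norm_mult mult.commute)
  qed
  show ?thesis
    by (rule Bochner_Integration.integrable_bound
        [where f = "\<lambda>y. B * (indicator K y + cmod (f y) powr p)"])
      (use Ki fp le \<open>B > 0\<close> in \<open>auto simp: abs_mult\<close>)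
qed

end

theory Submission
  imports Defs
begin

text \<open>
Choose \<open>\<psi> \<ge> 0\<close> continuous with compact support inside the neighbourhood \<open>U\<close> given by equicontinuity,
with \<open>\<integral>\<psi> = 1\<close>, and put \<open>\<phi> x = \<psi> (- x)\<close>. Left invariance turns the convolution into an average of
right translates,
\<open>(f \<star> \<phi>) x - f x = \<integral> (f (x + y) - f x) \<psi> y dy\<close>,
so the \<open>p\<close>-th power of its norm should be bounded by the supremum over \<open>y \<in> U\<close> of
\<open>\<integral> \<bar>f (x + y) - f x\<bar>\<^sup>p dx\<close>, by convexity and an exchange of the two integrals.

The exchange is the whole difficulty. The group need be neither \<open>\<sigma>\<close>-finite nor second countable, so
\<open>(x, y) \<mapsto> f (x + y)\<close> need not be measurable for the product of the Borel \<open>\<sigma>\<close>-algebras when \<open>f\<close> is merely Borel.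
For continuous integrands of compact support the obstacle disappears
(\<open>borel_measurable_pair_compactly_supported\<close>, \<open>tonelli_compactly_supported\<close>), which settles the case
of continuous \<open>f\<close> with compact support (\<open>convolve_compactly_supported_bound\<close>).

For \<open>f\<close> in \<open>L\<^sup>p\<close>, take continuous \<open>g\<^sub>n\<close> of compact support with \<open>\<integral> \<bar>f - g\<^sub>n\<bar>\<^sup>p \<le> 2\<^sup>-\<^sup>n\<close>
(\<open>Cc_approximable_of_Lp\<close>). Then \<open>g\<^sub>n \<star> \<phi> \<longlonglongrightarrow> f \<star> \<phi>\<close> pointwise and \<open>g\<^sub>n \<longlonglongrightarrow> f\<close> almost everywhere, and
Fatou's lemma transfers the bound, provided that the right translates of \<open>g\<^sub>n\<close> by \<open>y\<close> in the support
of \<open>\<psi>\<close> approximate those of \<open>f\<close> uniformly in \<open>y\<close>. The measure is only left invariant, so this requires that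
right translation by elements of a compact set increases integrals by at most a constant factor
(\<open>right_translate_bound\<close>). That is the existence and local boundedness of the modular function. It follows
from the two Tonelli exchanges in \<open>integral_mult_integral_eq_right_average\<close>, and passes from continuous
functions to Borel sets by regularity.

Since \<open>\<epsilon>\<close> is arbitrary, constant factors are harmless. This permits crude forms of the triangle inequality
and of Jensen's inequality with the constants \<open>3\<^sup>p\<close> and \<open>2\<^sup>p\<close>; equicontinuity is applied
with \<open>\<epsilon> / 6\<close> to absorb them.
\<close>

section \<open>Continuous functions of compact support\<close>

text \<open>
Compared with \<open>Cc\<close>, the values may lie in any normed space, since nonnegative real functions carry the
exchange of integrals; and the support is only required to lie in some compact set, which makes the
property easier to establish.
\<close>

definition compactly_supported :: "('a::topological_space \<Rightarrow> 'b::real_normed_vector) \<Rightarrow> bool" where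
  "compactly_supported g \<longleftrightarrow> continuous_on UNIV g \<and> (\<exists>K. compact K \<and> (\<forall>x. x \<notin> K \<longrightarrow> g x = 0))"

lemma compactly_supportedI: "continuous_on UNIV g \<Longrightarrow> compact K \<Longrightarrow> (\<And>x. x \<notin> K \<Longrightarrow> g x = 0) \<Longrightarrow> compactly_supported g"
  by (auto simp: compactly_supported_def)

lemma compactly_supported_in_Cc:
  fixes g :: "'a::t2_space \<Rightarrow> complex"
  assumes "compactly_supported g" shows "g \<in> Cc"
proof -
  obtain K where K: "compact K" "\<And>x. x \<notin> K \<Longrightarrow> g x = 0" "continuous_on UNIV g"
    using assms by (auto simp: compactly_supported_def)
  have "closure {x. g x \<noteq> 0} \<subseteq> K"
    using K by (intro closure_minimal compact_imp_closed) auto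
  then have "compact (closure {x. g x \<noteq> 0})"
    using K(1) by (metis closed_closure compact_Int_closed inf.absorb2)
  then show ?thesis using K by (auto simp: Cc_def)
qed

text \<open>
A finite union of open boxes lies in the product of the Borel \<open>\<sigma>\<close>-algebras even where arbitrary open sets of the
product do not.
\<close>

lemma compact_open_measurable_between:
  fixes C :: "('a::topological_space \<times> 'b::topological_space) set"
  assumes "compact C" "open V" "C \<subseteq> V"
  obtains R where "R \<in> sets (borel \<Otimes>\<^sub>M borel)" "C \<subseteq> R" "R \<subseteq> V"
proof -
  have "\<exists>A B. open A \<and> open B \<and> z \<in> A \<times> B \<and> A \<times> B \<subseteq> V" if "z \<in> C" for z
    using assms that open_prod_elim[of V z] by (metis subsetD)
  then obtain A B where AB: "\<And>z. z \<in> C \<Longrightarrow> open (A z) \<and> open (B z) \<and> z \<in> A z \<times> B z \<and> A z \<times> B z \<subseteq> V"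
    by metis
  obtain D where D: "D \<subseteq> C" "finite D" "C \<subseteq> (\<Union>z\<in>D. A z \<times> B z)"
    by (rule compactE_image[OF assms(1), of C "\<lambda>z. A z \<times> B z"]) (use AB in \<open>auto intro: open_Times\<close>)
  show thesis
  proof
    show "(\<Union>z\<in>D. A z \<times> B z) \<in> sets (borel \<Otimes>\<^sub>M borel)"
      using D AB by (intro sets.finite_UN pair_measureI) auto
  next
    show "C \<subseteq> (\<Union>z\<in>D. A z \<times> B z)" by (rule D)
    show "(\<Union>z\<in>D. A z \<times> B z) \<subseteq> V"
      using D(1) AB by (intro UN_least) blast
  qed
qed

text \<open>
For \<open>c > 0\<close> the superlevel set \<open>{F \<ge> c}\<close> is compact, so it is separated by a product-measurable set from the
complement of the open set \<open>{F > c - 1/n}\<close>; the intersection of these sets over \<open>n\<close> is \<open>{F \<ge> c}\<close>.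
\<close>

lemma borel_measurable_pair_compactly_supported:
  fixes F :: "'a::topological_space \<times> 'b::topological_space \<Rightarrow> real"
  assumes F: "compactly_supported F" and nonneg: "\<And>z. 0 \<le> F z"
  shows "F \<in> borel_measurable (borel \<Otimes>\<^sub>M borel)"
proof (subst borel_measurable_iff_ge, rule allI)
  fix c :: real
  obtain K where K: "compact K" "\<And>z. z \<notin> K \<Longrightarrow> F z = 0" and cont: "continuous_on UNIV F"
    using F by (auto simp: compactly_supported_def)
  show "{z \<in> space (borel \<Otimes>\<^sub>M borel). c \<le> F z} \<in> sets (borel \<Otimes>\<^sub>M borel)"
  proof (cases "c \<le> 0")
    case True
    then have "{z \<in> space (borel \<Otimes>\<^sub>M borel). c \<le> F z} = space (borel \<Otimes>\<^sub>M borel)"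
      using nonneg by (auto intro: order_trans)
    then show ?thesis by simp
  next
    case False
    have "{z. c \<le> F z} \<subseteq> K" using False K(2) by fastforce
    moreover have "closed {z. c \<le> F z}"
      by (intro closed_Collect_le cont continuous_intros)
    ultimately have C: "compact {z. c \<le> F z}"
      using K(1) by (metis compact_Int_closed inf.absorb2)
    have "\<exists>R. R \<in> sets (borel \<Otimes>\<^sub>M borel) \<and> {z. c \<le> F z} \<subseteq> R \<and> R \<subseteq> {z. c - 1 / real (Suc n) < F z}" for n
    proof -
      have op: "open {z. c - 1 / real (Suc n) < F z}"
        by (intro open_Collect_less cont continuous_intros)
      have "{z. c \<le> F z} \<subseteq> {z. c - 1 / real (Suc n) < F z}"
      proof
        fix z assume "z \<in> {z. c \<le> F z}"
        moreover have "0 < 1 / real (Suc n)" by simp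
        ultimately show "z \<in> {z. c - 1 / real (Suc n) < F z}" unfolding mem_Collect_eq by linarith
      qed
      then show ?thesis
        using compact_open_measurable_between[OF C op] by metis
    qed
    then obtain R where R: "\<And>n. R n \<in> sets (borel \<Otimes>\<^sub>M borel)" "\<And>n. {z. c \<le> F z} \<subseteq> R n"
      "\<And>n. R n \<subseteq> {z. c - 1 / real (Suc n) < F z}"
      by metis
    have "c \<le> F z" if "\<And>n. z \<in> R n" for z
    proof (rule ccontr)
      assume "\<not> c \<le> F z"
      then obtain n where "1 / real (Suc n) < c - F z"
        using nat_approx_posE[of "c - F z"] by auto
      with R(3)[of n] that[of n] show False by auto
    qed
    then have "{z \<in> space (borel \<Otimes>\<^sub>M borel). c \<le> F z} = (\<Inter>n. R n)"
      using R(2) by (auto simp: space_pair_measure)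
    then show ?thesis using R(1) by auto
  qed
qed

lemma Hausdorff_space_euclidean_t2: "Hausdorff_space (euclidean :: 'a::t2_space topology)"
proof -
  have "\<exists>U V. open U \<and> open V \<and> x \<in> U \<and> y \<in> V \<and> disjnt U V" if "x \<noteq> y" for x y :: 'a
    unfolding disjnt_def using hausdorff[OF that] .
  then show ?thesis by (simp add: Hausdorff_space_def)
qed

section \<open>Haar measure on a locally compact group\<close>

locale haar_group =
  fixes \<mu> :: "'a::{topological_group_add, t2_space} measure"
  assumes loc_compact: "locally_compact_space (euclidean :: 'a topology)"
    and haar: "left_haar_measure \<mu>"
begin

lemma sets_mu [measurable_cong, simp]: "sets \<mu> = sets borel"
  using haar by (simp add: left_haar_measure_def)

lemma space_mu [simp]: "space \<mu> = UNIV"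
  using sets_eq_imp_space_eq[OF sets_mu] by simp

lemma emeasure_compact: "compact K \<Longrightarrow> emeasure \<mu> K < \<infinity>"
  using haar by (simp add: left_haar_measure_def)

lemma emeasure_open: "open U \<Longrightarrow> emeasure \<mu> U = (SUP K\<in>{K. compact K \<and> K \<subseteq> U}. emeasure \<mu> K)"
  using haar by (simp add: left_haar_measure_def)

lemma emeasure_outer: "A \<in> sets borel \<Longrightarrow> emeasure \<mu> A = (INF U\<in>{U. open U \<and> A \<subseteq> U}. emeasure \<mu> U)"
  using haar by (simp add: left_haar_measure_def)

lemma compact_sets [measurable]: "compact K \<Longrightarrow> K \<in> sets borel" for K :: "'a set"
  by (simp add: borel_closed compact_imp_closed)

lemma translate_measurable [measurable]:
  "(\<lambda>y::'a. a + y) \<in> borel_measurable borel" "(\<lambda>y::'a. y + a) \<in> borel_measurable borel"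
  by (intro borel_measurable_continuous_onI continuous_intros)+

lemma distr_left_translate: "distr \<mu> borel (\<lambda>y. a + y) = \<mu>"
proof (rule measure_eqI)
  fix A assume "A \<in> sets (distr \<mu> borel (\<lambda>y. a + y))"
  then have A: "A \<in> sets borel" by simp
  have "(\<lambda>y. a + y) -` A = (\<lambda>y. - a + y) ` A"
  proof
    show "(\<lambda>y. a + y) -` A \<subseteq> (\<lambda>y. - a + y) ` A"
    proof
      fix y assume "y \<in> (\<lambda>y. a + y) -` A"
      then show "y \<in> (\<lambda>y. - a + y) ` A" by (intro image_eqI[of _ _ "a + y"]) (auto simp flip: add.assoc)
    qed
  qed (auto simp flip: add.assoc)
  then show "emeasure (distr \<mu> borel (\<lambda>y. a + y)) A = emeasure \<mu> A"
    using A haar by (simp add: emeasure_distr left_haar_measure_def)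
qed simp

lemma nn_integral_left_translate:
  assumes [measurable]: "h \<in> borel_measurable borel"
  shows "(\<integral>\<^sup>+ y. h (a + y) \<partial>\<mu>) = (\<integral>\<^sup>+ y. h y \<partial>\<mu>)"
proof -
  have "(\<integral>\<^sup>+ y. h y \<partial>\<mu>) = (\<integral>\<^sup>+ y. h y \<partial>distr \<mu> borel (\<lambda>y. a + y))"
    by (simp add: distr_left_translate)
  also have "\<dots> = (\<integral>\<^sup>+ y. h (a + y) \<partial>\<mu>)"
    by (intro nn_integral_distr) auto
  finally show ?thesis by simp
qed

lemma integral_left_translate:
  fixes h :: "'a \<Rightarrow> complex"
  assumes [measurable]: "h \<in> borel_measurable borel"
  shows "(\<integral> y. h (a + y) \<partial>\<mu>) = (\<integral> y. h y \<partial>\<mu>)"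
proof -
  have "(\<integral> y. h y \<partial>\<mu>) = (\<integral> y. h y \<partial>distr \<mu> borel (\<lambda>y. a + y))"
    by (simp add: distr_left_translate)
  also have "\<dots> = (\<integral> y. h (a + y) \<partial>\<mu>)"
    by (intro integral_distr) auto
  finally show ?thesis by simp
qed

text \<open>
Only the restriction of the measure to a compact square enters, and that restriction is finite, so the
usual theorem for \<open>\<sigma>\<close>-finite measures applies although \<open>\<mu>\<close> need not be \<open>\<sigma>\<close>-finite.
\<close>

lemma tonelli_compactly_supported:
  fixes F :: "'a \<Rightarrow> 'a \<Rightarrow> real"
  assumes F: "compactly_supported (\<lambda>(x, y). F x y)" and nonneg: "\<And>x y. 0 \<le> F x y"
  shows "(\<integral>\<^sup>+ x. \<integral>\<^sup>+ y. F x y \<partial>\<mu> \<partial>\<mu>) = (\<integral>\<^sup>+ y. \<integral>\<^sup>+ x. F x y \<partial>\<mu> \<partial>\<mu>)"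
proof -
  obtain C where C: "compact C" "\<And>z. z \<notin> C \<Longrightarrow> (\<lambda>(x, y). F x y) z = 0"
    using F by (auto simp: compactly_supported_def)
  define K where "K = fst ` C \<union> snd ` C"
  have K: "compact K" unfolding K_def
    by (intro compact_Un compact_continuous_image C continuous_intros)
  have F0: "F x y = 0" if "x \<notin> K \<or> y \<notin> K" for x y
    using C(2)[of "(x, y)"] that by (force simp: K_def)
  define N where "N = density \<mu> (indicator K)"
  have [measurable]: "K \<in> sets borel" using K by simp
  have [measurable_cong]: "sets N = sets borel" by (simp add: N_def)
  have "emeasure N (space N) = emeasure \<mu> K" by (simp add: N_def emeasure_density)
  then have "finite_measure N" using emeasure_compact[OF K] by (intro finite_measureI) auto
  then interpret N: finite_measure N .
  interpret NN: pair_sigma_finite N N ..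
  have [measurable]: "(\<lambda>(x, y). F x y) \<in> borel_measurable (borel \<Otimes>\<^sub>M borel)"
    using borel_measurable_pair_compactly_supported[OF F] nonneg by auto
  have m1: "(\<lambda>x. F x y) \<in> borel_measurable borel" and m2: "(\<lambda>y. F x y) \<in> borel_measurable borel" for x y
    by measurable
  have "sets (N \<Otimes>\<^sub>M N) = sets (borel \<Otimes>\<^sub>M borel)" by (intro sets_pair_measure_cong) (simp_all add: N_def)
  then have mN [measurable]: "(\<lambda>(x, y). F x y) \<in> borel_measurable (N \<Otimes>\<^sub>M N)"
    by measurable
  have N: "(\<integral>\<^sup>+ x. h x \<partial>N) = (\<integral>\<^sup>+ x. h x \<partial>\<mu>)"
    if "h \<in> borel_measurable borel" "\<And>x. x \<notin> K \<Longrightarrow> h x = 0" for h :: "'a \<Rightarrow> ennreal"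
    unfolding N_def using that
    by (subst nn_integral_density) (auto intro!: nn_integral_cong simp: indicator_def)
  have mx: "(\<lambda>x. \<integral>\<^sup>+ y. F x y \<partial>N) \<in> borel_measurable borel" by measurable
  have my: "(\<lambda>y. \<integral>\<^sup>+ x. F x y \<partial>N) \<in> borel_measurable borel" by measurable
  have "(\<integral>\<^sup>+ x. \<integral>\<^sup>+ y. F x y \<partial>\<mu> \<partial>\<mu>) = (\<integral>\<^sup>+ x. \<integral>\<^sup>+ y. F x y \<partial>N \<partial>\<mu>)"
    using m2 F0 by (intro nn_integral_cong N[symmetric]) auto
  also have "\<dots> = (\<integral>\<^sup>+ x. \<integral>\<^sup>+ y. F x y \<partial>N \<partial>N)"
    using mx F0 by (intro N[symmetric]) auto
  also have "\<dots> = (\<integral>\<^sup>+ y. \<integral>\<^sup>+ x. F x y \<partial>N \<partial>N)"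
    by (rule NN.Fubini'[symmetric, of "\<lambda>x y. ennreal (F x y)"]) (measurable; use mN in simp)
  also have "\<dots> = (\<integral>\<^sup>+ y. \<integral>\<^sup>+ x. F x y \<partial>N \<partial>\<mu>)"
    using my F0 by (intro N) auto
  also have "\<dots> = (\<integral>\<^sup>+ y. \<integral>\<^sup>+ x. F x y \<partial>\<mu> \<partial>\<mu>)"
    using m1 F0 by (intro nn_integral_cong N) auto
  finally show ?thesis .
qed

lemma compact_nbhd:
  assumes "compact (K :: 'a set)"
  obtains U L where "open U" "compact L" "K \<subseteq> U" "U \<subseteq> L"
proof -
  have "\<forall>K. compactin (euclidean :: 'a topology) K \<longrightarrow>
     (\<exists>U L. openin euclidean U \<and> compactin euclidean L \<and> closedin euclidean L \<and> K \<subseteq> U \<and> U \<subseteq> L)"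
    using loc_compact locally_compact_space_compact_closed_compact[OF disjI1[OF Hausdorff_space_euclidean_t2]]
    by (rule iffD1[rotated])
  then have "\<exists>U L. open U \<and> compact L \<and> K \<subseteq> U \<and> U \<subseteq> L"
    using assms unfolding compactin_euclidean_iff open_openin[symmetric] by metis
  then show thesis using that by metis
qed

text \<open>
A locally compact Hausdorff space is completely regular; cutting \<open>U\<close> down to a relatively compact
neighbourhood of \<open>K\<close> makes the support compact.
\<close>

lemma urysohn_compactly_supported:
  assumes K: "compact (K :: 'a set)" and U: "open U" "K \<subseteq> U"
  obtains g :: "'a \<Rightarrow> real" where "compactly_supported g" "\<And>x. 0 \<le> g x" "\<And>x. g x \<le> 1"
    "\<And>x. x \<in> K \<Longrightarrow> g x = 1" "\<And>x. x \<notin> U \<Longrightarrow> g x = 0"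
proof -
  obtain V L where V: "open V" "compact L" "K \<subseteq> V" "V \<subseteq> L"
    using compact_nbhd[OF K] .
  have "completely_regular_space (euclidean :: 'a topology)"
    by (rule locally_compact_regular_imp_completely_regular_space[OF loc_compact disjI1[OF Hausdorff_space_euclidean_t2]])
  moreover have "compactin euclidean K" using K by (simp add: compactin_euclidean_iff)
  moreover have "closedin euclidean (- (U \<inter> V))" using U(1) V(1)
    unfolding closed_closedin[symmetric] by (intro closed_Compl open_Int)
  moreover have "disjnt K (- (U \<inter> V))" using U(2) V(3) unfolding disjnt_def by blast
  ultimately obtain g where g: "continuous_map euclidean (top_of_set {0..1::real}) g"
    "g ` (- (U \<inter> V)) \<subseteq> {0}" "g ` K \<subseteq> {1}"
    using Urysohn_completely_regular_compact_closed[of 0 1 euclidean K "- (U \<inter> V)"] zero_le_one by metis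
  have "continuous_on UNIV g" "\<And>x. 0 \<le> g x \<and> g x \<le> 1"
    using g(1) by (auto simp: continuous_map_in_subtopology Pi_iff image_subset_iff)
  note cont = this
  have g0: "g x = 0" if "x \<notin> U \<or> x \<notin> V" for x
    using g(2) that by (simp add: image_subset_iff)
  have g1: "g x = 1" if "x \<in> K" for x
    using g(3) that by (simp add: image_subset_iff)
  have "g x = 0" if "x \<notin> L" for x
    using V(4) g0 that by blast
  then have "compactly_supported g"
    using cont V(2) by (intro compactly_supportedI[of g L])
  then show thesis using cont g0 g1 by (intro that[of g]) simp_all
qed

lemma integrable_compactly_supported:
  fixes g :: "'a \<Rightarrow> 'b::{banach, second_countable_topology}"
  assumes "compactly_supported g" shows "integrable \<mu> g"
proof -
  obtain K where K: "compact K" "\<And>x. x \<notin> K \<Longrightarrow> g x = 0" and cont: "continuous_on UNIV g"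
    using assms by (auto simp: compactly_supported_def)
  have "compact (g ` K)"
    using K cont by (meson compact_continuous_image continuous_on_subset top_greatest)
  then obtain B where B: "\<And>k. k \<in> K \<Longrightarrow> norm (g k) \<le> B"
    by (metis bounded_pos compact_imp_bounded imageI)
  have "g \<in> borel_measurable \<mu>" using borel_measurable_continuous_onI[OF cont] by simp
  then show ?thesis
    using K B emeasure_compact[OF K(1)] by (intro integrableI_bounded_set[of K \<mu> g B]) auto
qed

lemma nn_integral_compactly_supported:
  fixes g :: "'a \<Rightarrow> real"
  assumes "compactly_supported g" "\<And>x. 0 \<le> g x" shows "(\<integral>\<^sup>+ x. g x \<partial>\<mu>) = ennreal (\<integral>x. g x \<partial>\<mu>)"
  using assms by (intro nn_integral_eq_integral integrable_compactly_supported) auto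

text \<open>
Continuity is uniform along the compact set that carries all the functions \<open>F x\<close> for \<open>x\<close> near a given
point, and that set has finite measure.
\<close>

lemma continuous_on_param_integral:
  fixes F :: "'b::topological_space \<Rightarrow> 'a \<Rightarrow> 'c::{banach, second_countable_topology}"
  assumes cont: "continuous_on UNIV (\<lambda>(x, y). F x y)"
    and supp: "\<And>x0. \<exists>W L. open W \<and> x0 \<in> W \<and> compact L \<and> (\<forall>x\<in>W. \<forall>y. y \<notin> L \<longrightarrow> F x y = 0)"
  shows "continuous_on UNIV (\<lambda>x. \<integral>y. F x y \<partial>\<mu>)"
  unfolding continuous_on_def
proof (intro ballI tendstoI)
  fix x0 :: 'b and e :: real assume "e > 0"
  obtain W L where W: "open W" "x0 \<in> W" "compact L" "\<And>x y. x \<in> W \<Longrightarrow> y \<notin> L \<Longrightarrow> F x y = 0"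
    using supp[of x0] by blast
  define d where "d = e / (2 * (measure \<mu> L + 1))"
  have "d > 0" using \<open>e > 0\<close> by (simp add: d_def add_nonneg_pos)
  obtain X where X: "x0 \<in> X" "open X"
    "\<forall>x\<in>X \<inter> UNIV. \<forall>y\<in>L. dist ((\<lambda>(x, y). F x y) (x, y)) ((\<lambda>(x, y). F x y) (x0, y)) \<le> d"
    using continuous_on_prod_compactE[OF continuous_on_subset[OF cont] W(3) _ \<open>d > 0\<close>, of UNIV x0]
    by blast
  have int: "integrable \<mu> (F x)" if "x \<in> W" for x
    using W that continuous_on_compose2[OF cont continuous_on_Pair, of UNIV "\<lambda>_. x" "\<lambda>y. y"]
    by (intro integrable_compactly_supported compactly_supportedI[of _ L]) auto
  have Ls: "L \<in> sets \<mu>" using W by simp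
  have "dist (\<integral>y. F x y \<partial>\<mu>) (\<integral>y. F x0 y \<partial>\<mu>) < e" if "x \<in> X \<inter> W" for x
  proof -
    have "norm (\<integral>y. F x y - F x0 y \<partial>\<mu>) \<le> (\<integral>y. norm (F x y - F x0 y) \<partial>\<mu>)"
      by (rule integral_norm_bound)
    also have "\<dots> \<le> (\<integral>y. d * indicator L y \<partial>\<mu>)"
    proof (rule integral_mono)
      show "norm (F x y - F x0 y) \<le> d * indicator L y" for y
        using W X(3) that by (cases "y \<in> L") (auto simp: dist_norm)
    qed (use int that W Ls emeasure_compact in \<open>auto intro!: integrable_real_indicator\<close>)
    also have "\<dots> = d * measure \<mu> L" using Ls by simp
    also have "\<dots> \<le> d * (measure \<mu> L + 1)" using \<open>d > 0\<close> by (intro mult_left_mono) auto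
    also have "\<dots> = e / 2"
    proof -
      have "e / (2 * m) * m = e / 2" if "m \<noteq> 0" for m :: real using that by simp
      then show ?thesis unfolding d_def using measure_nonneg[of \<mu> L] by (smt (verit))
    qed
    also have "\<dots> < e" using \<open>e > 0\<close> by simp
    finally show ?thesis using int that W by (simp add: dist_norm)
  qed
  then show "\<forall>\<^sub>F x in at x0 within UNIV. dist (\<integral>y. F x y \<partial>\<mu>) (\<integral>y. F x0 y \<partial>\<mu>) < e"
    unfolding eventually_at_topological using X W by (intro exI[of _ "X \<inter> W"]) auto
qed

text \<open>
Finitely many left translates of \<open>U\<close> cover any compact set. If \<open>U\<close> were null, then so would be every
compact set, and hence the whole group by inner regularity.
\<close>

lemma emeasure_open_pos:
  assumes "open U" "x \<in> U" shows "emeasure \<mu> U \<noteq> 0"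
proof
  assume null: "emeasure \<mu> U = 0"
  have "emeasure \<mu> K = 0" if K: "compact K" for K
  proof -
    have tr: "emeasure \<mu> ((\<lambda>y. a + y) ` U) = 0" for a
      using null haar assms by (simp add: left_haar_measure_def)
    have op: "open ((\<lambda>y. a + y) ` U)" for a
    proof -
      have "(\<lambda>y. a + y) ` U = (\<lambda>y. - a + y) -` U"
        by (auto simp flip: add.assoc intro: image_eqI[of _ _ "- a + _"])
      moreover have "open ((\<lambda>y. - a + y) -` U)"
        by (intro open_vimage assms continuous_intros)
      ultimately show ?thesis by simp
    qed
    have "K \<subseteq> (\<Union>a\<in>UNIV. (\<lambda>y. a + y) ` U)"
    proof
      fix k :: 'a
      have "k = (k - x) + x" by simp
      then show "k \<in> (\<Union>a\<in>UNIV. (\<lambda>y. a + y) ` U)" using assms(2) by blast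
    qed
    then obtain D where D: "finite D" "K \<subseteq> (\<Union>a\<in>D. (\<lambda>y. a + y) ` U)"
      using compactE_image[OF K, of UNIV "\<lambda>a. (\<lambda>y. a + y) ` U"] op by metis
    have "emeasure \<mu> K \<le> emeasure \<mu> (\<Union>a\<in>D. (\<lambda>y. a + y) ` U)"
      using D op by (intro emeasure_mono) (auto intro!: sets.finite_UN)
    also have "\<dots> \<le> (\<Sum>a\<in>D. emeasure \<mu> ((\<lambda>y. a + y) ` U))"
      using D op by (intro emeasure_subadditive_finite) auto
    finally show ?thesis by (simp add: tr)
  qed
  then have "emeasure \<mu> UNIV = 0"
    by (subst emeasure_open) (auto simp flip: le_zero_eq intro!: SUP_least)
  then show False using haar by (simp add: left_haar_measure_def)
qed

lemma compactly_supported_measurable: "compactly_supported g \<Longrightarrow> g \<in> borel_measurable borel"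
  for g :: "'a \<Rightarrow> 'b::real_normed_vector"
  by (auto simp: compactly_supported_def intro: borel_measurable_continuous_onI)

lemma compact_plus: "compact K \<Longrightarrow> compact L \<Longrightarrow> compact ((\<lambda>(x, y). x + y :: 'a) ` (K \<times> L))"
  by (intro compact_continuous_image compact_Times) (auto simp: split_def intro!: continuous_intros)

lemma compact_uminus: "compact K \<Longrightarrow> compact (uminus ` K :: 'a set)"
  by (intro compact_continuous_image continuous_intros)

section \<open>Right translation and the modular function\<close>

lemma continuous_on_right_integral:
  fixes f :: "'a \<Rightarrow> real"
  assumes "compactly_supported f" shows "continuous_on UNIV (\<lambda>s. \<integral>t. f (t + s) \<partial>\<mu>)"
proof (rule continuous_on_param_integral)
  obtain K where K: "compact K" "\<And>x. x \<notin> K \<Longrightarrow> f x = 0" and cont: "continuous_on UNIV f"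
    using assms by (auto simp: compactly_supported_def)
  show "continuous_on UNIV (\<lambda>(s, t). f (t + s))"
    unfolding split_def by (intro continuous_on_compose2[OF cont] continuous_intros) auto
  fix s0 :: 'a
  obtain W L where W: "open W" "compact L" "{s0} \<subseteq> W" "W \<subseteq> L"
    using compact_nbhd[of "{s0}"] by auto
  let ?M = "(\<lambda>(x, y). x + y) ` (K \<times> uminus ` L)"
  have "f (t + s) = 0" if "s \<in> W" "t \<notin> ?M" for s t
  proof (rule K(2), rule notI)
    assume "t + s \<in> K"
    then have "(t + s) + - s \<in> ?M" using that W by force
    then show False using that by (simp add: add.assoc)
  qed
  moreover have "compact ?M" using K W by (intro compact_plus compact_uminus)
  ultimately show "\<exists>W L. open W \<and> s0 \<in> W \<and> compact L \<and> (\<forall>s\<in>W. \<forall>t. t \<notin> L \<longrightarrow> f (t + s) = 0)"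
    using W by (intro exI[of _ W] exI[of _ ?M]) auto
qed

lemma compactly_supported_right_translate:
  fixes f :: "'a \<Rightarrow> 'b::real_normed_vector"
  assumes "compactly_supported f" shows "compactly_supported (\<lambda>t. f (t + s))"
proof -
  obtain K where K: "compact K" "\<And>x. x \<notin> K \<Longrightarrow> f x = 0" and cont: "continuous_on UNIV f"
    using assms by (auto simp: compactly_supported_def)
  let ?M = "(\<lambda>t. t + - s) ` K"
  show ?thesis
  proof (rule compactly_supportedI[of _ ?M])
    show "continuous_on UNIV (\<lambda>t. f (t + s))"
      by (intro continuous_on_compose2[OF cont] continuous_intros) auto
    show "compact ?M" using K by (intro compact_continuous_image continuous_intros)
    show "f (t + s) = 0" if "t \<notin> ?M" for t
    proof (rule K(2), rule notI)
      assume "t + s \<in> K"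
      then have "(t + s) + - s \<in> ?M" by blast
      then show False using that by (simp add: add.assoc)
    qed
  qed
qed

lemma compactly_supported_inverse:
  fixes f :: "'a \<Rightarrow> 'b::real_normed_vector"
  assumes "compactly_supported f" shows "compactly_supported (\<lambda>t. f (- t))"
proof -
  obtain K where K: "compact K" "\<And>x. x \<notin> K \<Longrightarrow> f x = 0" and cont: "continuous_on UNIV f"
    using assms by (auto simp: compactly_supported_def)
  show ?thesis
  proof (rule compactly_supportedI[of _ "uminus ` K"])
    show "continuous_on UNIV (\<lambda>t. f (- t))"
      by (intro continuous_on_compose2[OF cont] continuous_intros) auto
    show "compact (uminus ` K)" using K by (intro compact_uminus)
    show "f (- t) = 0" if "t \<notin> uminus ` K" for t
      using that by (intro K(2)) (metis image_eqI minus_minus)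
  qed
qed

text \<open>
The key identity behind the uniqueness of Haar measure. Translate \<open>g\<close> by \<open>- s\<close>, exchange the integrals,
translate the variable \<open>s\<close> by \<open>t\<close>, and exchange again; only left invariance is used, but right translates
of \<open>f\<close> appear.
\<close>

lemma integral_mult_integral_eq_right_average:
  fixes f g :: "'a \<Rightarrow> real"
  assumes f: "compactly_supported f" "\<And>x. 0 \<le> f x" and g: "compactly_supported g" "\<And>x. 0 \<le> g x"
  shows "(\<integral>\<^sup>+ x. f x \<partial>\<mu>) * (\<integral>\<^sup>+ x. g x \<partial>\<mu>) = (\<integral>\<^sup>+ s. ennreal (g (- s)) * (\<integral>\<^sup>+ t. f (t + s) \<partial>\<mu>) \<partial>\<mu>)"
proof -
  obtain K where K: "compact K" "\<And>x. x \<notin> K \<Longrightarrow> f x = 0" and contf: "continuous_on UNIV f"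
    using f by (auto simp: compactly_supported_def)
  obtain L where L: "compact L" "\<And>x. x \<notin> L \<Longrightarrow> g x = 0" and contg: "continuous_on UNIV g"
    using g by (auto simp: compactly_supported_def)
  have [measurable]: "f \<in> borel_measurable borel" "g \<in> borel_measurable borel"
    using f g by (auto intro: compactly_supported_measurable)
  have [measurable]: "(\<lambda>t::'a. - t) \<in> borel_measurable borel"
    by (intro borel_measurable_continuous_onI continuous_intros)
  have cc1: "compactly_supported (\<lambda>(s, t). f s * g (- s + t))"
  proof (rule compactly_supportedI[of _ "K \<times> (\<lambda>(x, y). x + y) ` (K \<times> L)"])
    show "continuous_on UNIV (\<lambda>(s, t). f s * g (- s + t))"
      unfolding split_def
      by (intro continuous_intros continuous_on_compose2[OF contf] continuous_on_compose2[OF contg]) auto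
    show "compact (K \<times> (\<lambda>(x, y). x + y) ` (K \<times> L))"
      using K L by (intro compact_Times compact_plus)
    fix z assume z: "z \<notin> K \<times> (\<lambda>(x, y). x + y) ` (K \<times> L)"
    obtain s t where st: "z = (s, t)" by (cases z)
    have "f s = 0 \<or> g (- s + t) = 0"
    proof (rule ccontr)
      assume "\<not> ?thesis"
      then have "s \<in> K" "- s + t \<in> L" using K(2) L(2) by auto
      moreover have "t = s + (- s + t)" by (simp flip: add.assoc)
      ultimately show False using z st by force
    qed
    then show "(\<lambda>(s, t). f s * g (- s + t)) z = 0" using st by auto
  qed
  have cc2: "compactly_supported (\<lambda>(t, s). f (t + s) * g (- s))"
  proof (rule compactly_supportedI[of _ "(\<lambda>(x, y). x + y) ` (K \<times> L) \<times> uminus ` L"])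
    show "continuous_on UNIV (\<lambda>(t, s). f (t + s) * g (- s))"
      unfolding split_def
      by (intro continuous_intros continuous_on_compose2[OF contf] continuous_on_compose2[OF contg]) auto
    show "compact ((\<lambda>(x, y). x + y) ` (K \<times> L) \<times> uminus ` L)"
      using K L by (intro compact_Times compact_plus compact_uminus)
    fix z assume z: "z \<notin> (\<lambda>(x, y). x + y) ` (K \<times> L) \<times> uminus ` L"
    obtain t s where st: "z = (t, s)" by (cases z)
    have "f (t + s) = 0 \<or> g (- s) = 0"
    proof (rule ccontr)
      assume "\<not> ?thesis"
      then have "t + s \<in> K" "- s \<in> L" using K(2) L(2) by auto
      moreover have "t = (t + s) + - s" by (simp add: add.assoc)
      moreover have "s = - (- s)" by simp
      ultimately show False using z st by (metis (mono_tags, lifting) SigmaI case_prod_conv imageI)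
    qed
    then show "(\<lambda>(t, s). f (t + s) * g (- s)) z = 0" using st by auto
  qed
  have "(\<integral>\<^sup>+ x. f x \<partial>\<mu>) * (\<integral>\<^sup>+ x. g x \<partial>\<mu>) = (\<integral>\<^sup>+ s. ennreal (f s) * (\<integral>\<^sup>+ t. g t \<partial>\<mu>) \<partial>\<mu>)"
    by (simp add: nn_integral_multc)
  also have "\<dots> = (\<integral>\<^sup>+ s. \<integral>\<^sup>+ t. ennreal (f s * g (- s + t)) \<partial>\<mu> \<partial>\<mu>)"
  proof (rule nn_integral_cong)
    fix s
    have "(\<integral>\<^sup>+ t. g t \<partial>\<mu>) = (\<integral>\<^sup>+ t. g (- s + t) \<partial>\<mu>)"
      by (rule nn_integral_left_translate[symmetric]) simp
    then show "ennreal (f s) * (\<integral>\<^sup>+ t. g t \<partial>\<mu>) = (\<integral>\<^sup>+ t. ennreal (f s * g (- s + t)) \<partial>\<mu>)"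
      using f g by (simp add: ennreal_mult nn_integral_cmult)
  qed
  also have "\<dots> = (\<integral>\<^sup>+ t. \<integral>\<^sup>+ s. ennreal (f s * g (- s + t)) \<partial>\<mu> \<partial>\<mu>)"
    using f g by (intro tonelli_compactly_supported cc1) auto
  also have "\<dots> = (\<integral>\<^sup>+ t. \<integral>\<^sup>+ s. ennreal (f (t + s) * g (- s)) \<partial>\<mu> \<partial>\<mu>)"
  proof (rule nn_integral_cong)
    fix t
    have "(\<integral>\<^sup>+ s. ennreal (f s * g (- s + t)) \<partial>\<mu>) = (\<integral>\<^sup>+ s. ennreal (f (t + s) * g (- (t + s) + t)) \<partial>\<mu>)"
      by (rule nn_integral_left_translate[symmetric, of "\<lambda>s. ennreal (f s * g (- s + t))"]) measurable
    then show "(\<integral>\<^sup>+ s. ennreal (f s * g (- s + t)) \<partial>\<mu>) = (\<integral>\<^sup>+ s. ennreal (f (t + s) * g (- s)) \<partial>\<mu>)"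
      by (simp add: minus_add add.assoc)
  qed
  also have "\<dots> = (\<integral>\<^sup>+ s. \<integral>\<^sup>+ t. ennreal (f (t + s) * g (- s)) \<partial>\<mu> \<partial>\<mu>)"
    using f g by (intro tonelli_compactly_supported cc2) auto
  also have "\<dots> = (\<integral>\<^sup>+ s. ennreal (g (- s)) * (\<integral>\<^sup>+ t. f (t + s) \<partial>\<mu>) \<partial>\<mu>)"
    using f g by (intro nn_integral_cong) (simp add: ennreal_mult nn_integral_multc, rule mult.commute)
  finally show ?thesis .
qed

text \<open>
A continuous function is determined by its integrals against continuous test functions of compact support,
because nonempty open sets have positive measure. The bound is stated in one direction so that the
integrands stay nonnegative.
\<close>

lemma le_if_integrals_eq:
  fixes a b :: "'a \<Rightarrow> real"
  assumes cont: "continuous_on UNIV a" "continuous_on UNIV b"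
    and nonneg: "\<And>s. 0 \<le> a s" "\<And>s. 0 \<le> b s"
    and eq: "\<And>h. compactly_supported h \<Longrightarrow> (\<And>s. 0 \<le> h s) \<Longrightarrow> (\<integral>\<^sup>+ s. ennreal (h s * a s) \<partial>\<mu>) = (\<integral>\<^sup>+ s. ennreal (h s * b s) \<partial>\<mu>)"
    and fin: "\<And>h. compactly_supported h \<Longrightarrow> (\<And>s. 0 \<le> h s) \<Longrightarrow> (\<integral>\<^sup>+ s. ennreal (h s * a s) \<partial>\<mu>) < \<infinity>"
  shows "b s0 \<le> a s0"
proof (rule ccontr)
  assume "\<not> b s0 \<le> a s0"
  \<comment> \<open>A bump function at \<open>s0\<close> supported where \<open>a < b\<close> gives \<open>h (b - a)\<close> integral zero, yet this continuous nonnegative function is positive at \<open>s0\<close>.\<close>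
  define W where "W = {s. a s < b s}"
  have W: "open W" "s0 \<in> W"
    unfolding W_def using \<open>\<not> b s0 \<le> a s0\<close> by (auto intro!: open_Collect_less cont)
  obtain h :: "'a \<Rightarrow> real" where h: "compactly_supported h" "\<And>x. 0 \<le> h x" "\<And>x. h x \<le> 1"
      "\<And>x. x \<in> {s0} \<Longrightarrow> h x = 1" "\<And>x. x \<notin> W \<Longrightarrow> h x = 0"
    by (rule urysohn_compactly_supported[of "{s0}" W]) (use W in auto)
  have conth: "continuous_on UNIV h" using h by (simp add: compactly_supported_def)
  have [measurable]: "a \<in> borel_measurable borel" "b \<in> borel_measurable borel" "h \<in> borel_measurable borel"
    using cont conth by (auto intro: borel_measurable_continuous_onI)
  let ?d = "\<lambda>s. h s * (b s - a s)"
  have d: "0 \<le> ?d s" for s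
    using h(2)[of s] h(5)[of s] by (cases "s \<in> W") (auto simp: W_def)
  have "(\<integral>\<^sup>+ s. ennreal (h s * a s) \<partial>\<mu>) + (\<integral>\<^sup>+ s. ennreal (?d s) \<partial>\<mu>) = (\<integral>\<^sup>+ s. ennreal (h s * a s) + ennreal (?d s) \<partial>\<mu>)"
    by (rule nn_integral_add[symmetric]) measurable
  also have "\<dots> = (\<integral>\<^sup>+ s. ennreal (h s * b s) \<partial>\<mu>)"
    using d h nonneg by (intro nn_integral_cong) (simp flip: ennreal_plus add: algebra_simps)
  also have "\<dots> = (\<integral>\<^sup>+ s. ennreal (h s * a s) \<partial>\<mu>)" using eq[OF h(1,2)] by simp
  finally have "(\<integral>\<^sup>+ s. ennreal (?d s) \<partial>\<mu>) = 0"
    using fin[OF h(1,2)] by (metis add.right_neutral ennreal_add_left_cancel infinity_ennreal_def less_irrefl)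
  then have "AE s in \<mu>. ennreal (?d s) = 0"
    by (subst (asm) nn_integral_0_iff_AE) measurable
  then have "AE s in \<mu>. s \<notin> {s. 0 < ?d s}"
    by eventually_elim (simp add: ennreal_eq_0_iff not_less)
  moreover have op: "open {s. 0 < ?d s}"
    by (intro open_Collect_less cont conth continuous_intros)
  ultimately have "emeasure \<mu> {s. 0 < ?d s} = 0"
    by (subst (asm) AE_iff_measurable[of "{s. 0 < ?d s}"]) auto
  moreover have "s0 \<in> {s. 0 < ?d s}"
    using W h(4) by (simp add: W_def)
  ultimately show False using emeasure_open_pos[OF op] by blast
qed

text \<open>
By \<open>integral_mult_integral_eq_right_average\<close> both sides, as functions of \<open>s\<close>, have the same integrals against every
test function. Exchanging \<open>f\<close> and \<open>f'\<close> gives equality: the ratio of \<open>\<integral> f (t + s) dt\<close> to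
\<open>\<integral> f\<close> does not depend on \<open>f\<close>. It is the value at \<open>s\<close> of the modular function, up to inversion.
\<close>

lemma right_translate_integral_ratio_le:
  fixes f f' :: "'a \<Rightarrow> real"
  assumes f: "compactly_supported f" "\<And>x. 0 \<le> f x" and f': "compactly_supported f'" "\<And>x. 0 \<le> f' x"
  shows "(\<integral>x. f x \<partial>\<mu>) * (\<integral>t. f' (t + s) \<partial>\<mu>) \<le> (\<integral>x. f' x \<partial>\<mu>) * (\<integral>t. f (t + s) \<partial>\<mu>)"
proof (rule le_if_integrals_eq)
  have tr: "(\<integral>\<^sup>+ t. u (t + s) \<partial>\<mu>) = ennreal (\<integral>t. u (t + s) \<partial>\<mu>)" if "compactly_supported u" "\<And>x. 0 \<le> u x" for u :: "'a \<Rightarrow> real" and s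
    using that by (intro nn_integral_compactly_supported compactly_supported_right_translate)
  have I0: "0 \<le> (\<integral>x. u x \<partial>\<mu>)" if "\<And>x. 0 \<le> u x" for u :: "'a \<Rightarrow> real"
    using that by simp
  have E: "(\<integral>\<^sup>+ s. ennreal (h s * ((\<integral>x. v x \<partial>\<mu>) * (\<integral>t. u (t + s) \<partial>\<mu>))) \<partial>\<mu>)
      = ennreal (\<integral>x. v x \<partial>\<mu>) * ennreal (\<integral>x. u x \<partial>\<mu>) * ennreal (\<integral>x. h (- x) \<partial>\<mu>)"
    if h: "compactly_supported h" "\<And>s. 0 \<le> h s" and u: "compactly_supported u" "\<And>x. 0 \<le> u x" and v: "compactly_supported v" "\<And>x. 0 \<le> v x" for h u v :: "'a \<Rightarrow> real"
  proof -
    have [measurable]: "(\<lambda>s. \<integral>t. u (t + s) \<partial>\<mu>) \<in> borel_measurable borel" "h \<in> borel_measurable borel"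
      using continuous_on_right_integral[OF u(1)] h by (auto intro: borel_measurable_continuous_onI compactly_supported_measurable)
    have "(\<integral>\<^sup>+ s. ennreal (h s * ((\<integral>x. v x \<partial>\<mu>) * (\<integral>t. u (t + s) \<partial>\<mu>))) \<partial>\<mu>)
       = (\<integral>\<^sup>+ s. ennreal (\<integral>x. v x \<partial>\<mu>) * (ennreal (h s) * ennreal (\<integral>t. u (t + s) \<partial>\<mu>)) \<partial>\<mu>)"
      using h u v I0 by (intro nn_integral_cong) (simp flip: ennreal_mult add: mult.left_commute)
    also have "\<dots> = ennreal (\<integral>x. v x \<partial>\<mu>) * (\<integral>\<^sup>+ s. ennreal (h s) * ennreal (\<integral>t. u (t + s) \<partial>\<mu>) \<partial>\<mu>)"
      by (rule nn_integral_cmult) measurable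
    also have "(\<integral>\<^sup>+ s. ennreal (h s) * ennreal (\<integral>t. u (t + s) \<partial>\<mu>) \<partial>\<mu>)
       = (\<integral>\<^sup>+ s. ennreal (h (- (- s))) * (\<integral>\<^sup>+ t. u (t + s) \<partial>\<mu>) \<partial>\<mu>)"
      using u by (simp add: tr)
    also have "\<dots> = (\<integral>\<^sup>+ x. u x \<partial>\<mu>) * (\<integral>\<^sup>+ x. h (- x) \<partial>\<mu>)"
      by (rule integral_mult_integral_eq_right_average[OF u compactly_supported_inverse[OF h(1)], symmetric]) (rule h)
    also have "\<dots> = ennreal (\<integral>x. u x \<partial>\<mu>) * ennreal (\<integral>x. h (- x) \<partial>\<mu>)"
      using u h by (simp add: nn_integral_compactly_supported compactly_supported_inverse)
    finally show ?thesis by (simp add: mult.assoc)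
  qed
  show "continuous_on UNIV (\<lambda>s. (\<integral>x. f' x \<partial>\<mu>) * (\<integral>t. f (t + s) \<partial>\<mu>))"
       "continuous_on UNIV (\<lambda>s. (\<integral>x. f x \<partial>\<mu>) * (\<integral>t. f' (t + s) \<partial>\<mu>))"
    using f f' by (intro continuous_intros continuous_on_right_integral; simp)+
  show "0 \<le> (\<integral>x. f' x \<partial>\<mu>) * (\<integral>t. f (t + s) \<partial>\<mu>)"
       "0 \<le> (\<integral>x. f x \<partial>\<mu>) * (\<integral>t. f' (t + s) \<partial>\<mu>)" for s
    using f f' by simp_all
  fix h :: "'a \<Rightarrow> real" assume h: "compactly_supported h" "\<And>s. 0 \<le> h s"
  show "(\<integral>\<^sup>+ s. ennreal (h s * ((\<integral>x. f' x \<partial>\<mu>) * (\<integral>t. f (t + s) \<partial>\<mu>))) \<partial>\<mu>)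
      = (\<integral>\<^sup>+ s. ennreal (h s * ((\<integral>x. f x \<partial>\<mu>) * (\<integral>t. f' (t + s) \<partial>\<mu>))) \<partial>\<mu>)"
    unfolding E[OF h f f'] E[OF h f' f] by (simp add: mult.commute)
  show "(\<integral>\<^sup>+ s. ennreal (h s * ((\<integral>x. f' x \<partial>\<mu>) * (\<integral>t. f (t + s) \<partial>\<mu>))) \<partial>\<mu>) < \<infinity>"
    unfolding E[OF h f f'] by (simp add: ennreal_mult_less_top)
qed

lemma integral_compactly_supported_pos:
  fixes f :: "'a \<Rightarrow> real"
  assumes f: "compactly_supported f" "\<And>x. 0 \<le> f x" and x0: "0 < f x0"
  shows "0 < (\<integral>x. f x \<partial>\<mu>)"
proof (rule ccontr)
  assume "\<not> ?thesis"
  then have "(\<integral>\<^sup>+ x. f x \<partial>\<mu>) = 0"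
    using f by (simp add: nn_integral_compactly_supported not_less ennreal_neg)
  then have "AE x in \<mu>. x \<notin> {x. 0 < f x}"
    using compactly_supported_measurable[OF f(1)] by (subst (asm) nn_integral_0_iff_AE) (auto simp: ennreal_eq_0_iff not_less)
  moreover have op: "open {x. 0 < f x}"
    using f(1) by (intro open_Collect_less continuous_intros) (simp add: compactly_supported_def)
  ultimately have "emeasure \<mu> {x. 0 < f x} = 0"
    by (subst (asm) AE_iff_measurable[of "{x. 0 < f x}"]) auto
  then show False using emeasure_open_pos[OF op, of x0] x0 by simp
qed

text \<open>
A single fixed bump function computes the ratio for all \<open>g\<close>, and its right integrals depend continuously on
the translation, so they are bounded on \<open>Q\<close>.
\<close>

lemma right_translate_bound_compactly_supported:
  assumes Q: "compact Q"
  obtains c :: real where "0 < c"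
    "\<And>y (g::'a \<Rightarrow> real). y \<in> Q \<Longrightarrow> compactly_supported g \<Longrightarrow> (\<And>x. 0 \<le> g x) \<Longrightarrow> (\<integral>\<^sup>+ x. g (x + y) \<partial>\<mu>) \<le> ennreal c * (\<integral>\<^sup>+ x. g x \<partial>\<mu>)"
proof -
  obtain f :: "'a \<Rightarrow> real" where f: "compactly_supported f" "\<And>x. 0 \<le> f x" "\<And>x. f x \<le> 1"
      "\<And>x. x \<in> {0} \<Longrightarrow> f x = 1" "\<And>x. x \<notin> UNIV \<Longrightarrow> f x = 0"
    by (rule urysohn_compactly_supported[of "{0}" UNIV]) auto
  define I where "I = (\<integral>x. f x \<partial>\<mu>)"
  have "I > 0"
    unfolding I_def using f by (intro integral_compactly_supported_pos[of f 0]) auto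
  define D where "D s = (\<integral>t. f (t + s) \<partial>\<mu>)" for s
  have "continuous_on Q D"
    using continuous_on_right_integral[OF f(1)] unfolding D_def by (rule continuous_on_subset) simp
  then have "bounded (D ` Q)" using Q by (simp add: compact_imp_bounded compact_continuous_image)
  then obtain B where B: "\<And>y. y \<in> Q \<Longrightarrow> norm (D y) \<le> B" and "B > 0"
    unfolding bounded_pos by auto
  show thesis
  proof
    show "0 < B / I" using \<open>B > 0\<close> \<open>I > 0\<close> by simp
    fix y and g :: "'a \<Rightarrow> real" assume y: "y \<in> Q" and g: "compactly_supported g" "\<And>x. 0 \<le> g x"
    have "I * (\<integral>t. g (t + y) \<partial>\<mu>) \<le> (\<integral>x. g x \<partial>\<mu>) * D y"
      unfolding I_def D_def by (rule right_translate_integral_ratio_le[OF f(1,2) g])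
    also have "\<dots> \<le> (\<integral>x. g x \<partial>\<mu>) * B"
      using B[OF y] g by (intro mult_left_mono) auto
    finally have "(\<integral>t. g (t + y) \<partial>\<mu>) \<le> B / I * (\<integral>x. g x \<partial>\<mu>)"
      using \<open>I > 0\<close> by (simp add: field_simps)
    then show "(\<integral>\<^sup>+ x. g (x + y) \<partial>\<mu>) \<le> ennreal (B / I) * (\<integral>\<^sup>+ x. g x \<partial>\<mu>)"
      using g \<open>B > 0\<close> \<open>I > 0\<close>
      by (simp add: nn_integral_compactly_supported compactly_supported_right_translate flip: ennreal_mult)
  qed
qed

text \<open>
The bound passes from continuous functions to open sets by inner regularity, to Borel sets by outer
regularity, and then to all nonnegative Borel functions by comparing the translated measure with \<open>c \<mu>\<close>.
\<close>

lemma right_translate_bound: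
  assumes Q: "compact Q"
  obtains c :: real where "0 < c"
    "\<And>y (h::'a \<Rightarrow> ennreal). y \<in> Q \<Longrightarrow> h \<in> borel_measurable borel \<Longrightarrow>
       (\<integral>\<^sup>+ x. h (x + y) \<partial>\<mu>) \<le> ennreal c * (\<integral>\<^sup>+ x. h x \<partial>\<mu>)"
proof -
  obtain c where c: "0 < c" "\<And>y (g::'a \<Rightarrow> real). y \<in> Q \<Longrightarrow> compactly_supported g \<Longrightarrow> (\<And>x. 0 \<le> g x) \<Longrightarrow> (\<integral>\<^sup>+ x. g (x + y) \<partial>\<mu>) \<le> ennreal c * (\<integral>\<^sup>+ x. g x \<partial>\<mu>)"
    using right_translate_bound_compactly_supported[OF Q] by blast
  have opn: "emeasure \<mu> ((\<lambda>x. x + y) -` U) \<le> ennreal c * emeasure \<mu> U" if y: "y \<in> Q" and U: "open U" for y U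
  proof -
    have "open ((\<lambda>x. x + y) -` U)" by (intro open_vimage U continuous_intros)
    then have "emeasure \<mu> ((\<lambda>x. x + y) -` U) = (SUP K\<in>{K. compact K \<and> K \<subseteq> (\<lambda>x. x + y) -` U}. emeasure \<mu> K)"
      by (rule emeasure_open)
    also have "\<dots> \<le> ennreal c * emeasure \<mu> U"
    proof (rule SUP_least)
      fix K assume "K \<in> {K. compact K \<and> K \<subseteq> (\<lambda>x. x + y) -` U}"
      then have K: "compact K" "K \<subseteq> (\<lambda>x. x + y) -` U" by auto
      have "compact ((\<lambda>x. x + y) ` K)" using K by (intro compact_continuous_image continuous_intros)
      then obtain g :: "'a \<Rightarrow> real" where g: "compactly_supported g" "\<And>x. 0 \<le> g x" "\<And>x. g x \<le> 1"
          "\<And>x. x \<in> (\<lambda>x. x + y) ` K \<Longrightarrow> g x = 1" "\<And>x. x \<notin> U \<Longrightarrow> g x = 0"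
        using urysohn_compactly_supported[of "(\<lambda>x. x + y) ` K" U] U K by blast
      have "emeasure \<mu> K = (\<integral>\<^sup>+ x. indicator K x \<partial>\<mu>)" using K by simp
      also have "\<dots> \<le> (\<integral>\<^sup>+ x. g (x + y) \<partial>\<mu>)"
        using g by (intro nn_integral_mono) (auto simp: indicator_def)
      also have "\<dots> \<le> ennreal c * (\<integral>\<^sup>+ x. g x \<partial>\<mu>)" using c(2)[OF y g(1,2)] .
      also have "(\<integral>\<^sup>+ x. g x \<partial>\<mu>) \<le> (\<integral>\<^sup>+ x. indicator U x \<partial>\<mu>)"
        using g by (intro nn_integral_mono) (auto simp: indicator_def)
      also have "\<dots> = emeasure \<mu> U" using U by simp
      finally show "emeasure \<mu> K \<le> ennreal c * emeasure \<mu> U" by (simp add: mult_left_mono)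
    qed
    finally show ?thesis .
  qed
  have set: "emeasure \<mu> ((\<lambda>x. x + y) -` A) \<le> ennreal c * emeasure \<mu> A" if y: "y \<in> Q" and A: "A \<in> sets borel" for y A
  proof -
    \<comment> \<open>The infimum over open supersets is taken of \<open>\<mu> U\<close> alone, so the constant is moved to the other side.\<close>
    have inv: "ennreal c * ennreal (1 / c) = 1"
      using c(1) by (simp flip: ennreal_mult)
    have "ennreal (1 / c) * emeasure \<mu> ((\<lambda>x. x + y) -` A) \<le> (INF U\<in>{U. open U \<and> A \<subseteq> U}. emeasure \<mu> U)"
    proof (rule INF_greatest)
      fix U assume "U \<in> {U. open U \<and> A \<subseteq> U}"
      then have U: "open U" "A \<subseteq> U" by auto
      have "open ((\<lambda>x. x + y) -` U)" (is "open ?W") by (intro open_vimage U continuous_intros)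
      have "emeasure \<mu> ((\<lambda>x. x + y) -` A) \<le> emeasure \<mu> ((\<lambda>x. x + y) -` U)"
        using U \<open>open ?W\<close> by (intro emeasure_mono) auto
      also have "\<dots> \<le> ennreal c * emeasure \<mu> U" by (rule opn[OF y U(1)])
      finally have "ennreal (1 / c) * emeasure \<mu> ((\<lambda>x. x + y) -` A) \<le> ennreal (1 / c) * (ennreal c * emeasure \<mu> U)"
        by (rule mult_left_mono) simp
      also have "\<dots> = emeasure \<mu> U" using inv by (simp add: mult.assoc[symmetric] mult.commute)
      finally show "ennreal (1 / c) * emeasure \<mu> ((\<lambda>x. x + y) -` A) \<le> emeasure \<mu> U" .
    qed
    then have "ennreal c * (ennreal (1 / c) * emeasure \<mu> ((\<lambda>x. x + y) -` A)) \<le> ennreal c * emeasure \<mu> A"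
      unfolding emeasure_outer[OF A, symmetric] by (rule mult_left_mono) simp
    then show ?thesis by (simp add: mult.assoc[symmetric] inv)
  qed
  show thesis
  proof (rule that[OF c(1)])
    fix y and h :: "'a \<Rightarrow> ennreal" assume y: "y \<in> Q" and [measurable]: "h \<in> borel_measurable borel"
    have le: "distr \<mu> borel (\<lambda>x. x + y) \<le> scale_measure (ennreal c) \<mu>"
      using set[OF y] by (subst le_measure) (auto simp: emeasure_distr)
    have "(\<integral>\<^sup>+ x. h (x + y) \<partial>\<mu>) = (\<integral>\<^sup>+ x. h x \<partial>distr \<mu> borel (\<lambda>x. x + y))"
      by (rule nn_integral_distr[symmetric]) auto
    also have "\<dots> \<le> (\<integral>\<^sup>+ x. h x \<partial>scale_measure (ennreal c) \<mu>)"
      by (rule nn_integral_mono_measure[OF _ le]) simp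
    also have "\<dots> = ennreal c * (\<integral>\<^sup>+ x. h x \<partial>\<mu>)"
      by (rule nn_integral_scale_measure) simp
    finally show "(\<integral>\<^sup>+ x. h (x + y) \<partial>\<mu>) \<le> ennreal c * (\<integral>\<^sup>+ x. h x \<partial>\<mu>)" .
  qed
qed

end

section \<open>Inequalities for \<open>p\<close>-th powers\<close>

text \<open>
A substitute for Minkowski's inequality that works under the integral sign.
\<close>

lemma powr_triangle3:
  fixes a b c :: complex
  assumes "0 \<le> p"
  shows "cmod (a + b + c) powr p \<le> 3 powr p * (cmod a powr p + cmod b powr p + cmod c powr p)"
proof -
  define m where "m = max (cmod a) (max (cmod b) (cmod c))"
  have "cmod (a + b + c) \<le> 3 * m"
    unfolding m_def using norm_triangle_ineq[of "a + b" c] norm_triangle_ineq[of a b] by linarith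
  then have "cmod (a + b + c) powr p \<le> (3 * m) powr p"
    using assms by (intro powr_mono2) auto
  also have "\<dots> = 3 powr p * m powr p" by (simp add: powr_mult m_def)
  also have "m powr p \<le> cmod a powr p + cmod b powr p + cmod c powr p"
    unfolding m_def max_def by auto
  finally show ?thesis by simp
qed

lemma nn_integral_powr_triangle3:
  fixes a b c :: "'a \<Rightarrow> complex"
  assumes [measurable]: "a \<in> borel_measurable M" "b \<in> borel_measurable M" "c \<in> borel_measurable M"
    and p: "0 \<le> p"
  shows "(\<integral>\<^sup>+ x. ennreal (cmod (a x + b x + c x) powr p) \<partial>M)
    \<le> ennreal (3 powr p) * ((\<integral>\<^sup>+ x. ennreal (cmod (a x) powr p) \<partial>M)
      + (\<integral>\<^sup>+ x. ennreal (cmod (b x) powr p) \<partial>M) + (\<integral>\<^sup>+ x. ennreal (cmod (c x) powr p) \<partial>M))"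
proof -
  have "(\<integral>\<^sup>+ x. ennreal (cmod (a x + b x + c x) powr p) \<partial>M)
    \<le> (\<integral>\<^sup>+ x. ennreal (3 powr p) * (ennreal (cmod (a x) powr p) + ennreal (cmod (b x) powr p) + ennreal (cmod (c x) powr p)) \<partial>M)"
    using powr_triangle3[OF p]
    by (intro nn_integral_mono) (simp flip: ennreal_plus ennreal_mult add: ennreal_leI)
  then show ?thesis
    by (simp add: nn_integral_cmult nn_integral_add)
qed

text \<open>
Jensen's inequality for the probability density \<open>w\<close>, up to the factor \<open>2\<^sup>p\<close>. With this loss it follows
from the elementary bound \<open>a \<le> r + r\<^sup>1\<^sup>-\<^sup>p a\<^sup>p\<close> for \<open>r > 0\<close>, averaged against \<open>w\<close>.
\<close>

lemma powr_norm_average_le: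
  fixes u :: "'a \<Rightarrow> complex" and w :: "'a \<Rightarrow> real"
  assumes [measurable]: "u \<in> borel_measurable M" "w \<in> borel_measurable M"
    and w: "\<And>y. 0 \<le> w y" "(\<integral>\<^sup>+ y. w y \<partial>M) = 1" and p: "1 \<le> p"
  shows "ennreal (cmod (\<integral>y. u y * of_real (w y) \<partial>M) powr p)
    \<le> ennreal (2 powr p) * (\<integral>\<^sup>+ y. ennreal (cmod (u y) powr p * w y) \<partial>M)"
proof (cases "(\<integral>\<^sup>+ y. ennreal (cmod (u y) powr p * w y) \<partial>M)" rule: ennreal_cases)
  case top
  then show ?thesis by (simp add: ennreal_mult_top)
next
  case (real t)
  let ?I = "\<integral>y. u y * of_real (w y) \<partial>M"
  have key: "cmod ?I \<le> r + r powr (1 - p) * t" if r: "0 < r" for r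
  proof -
    have pw: "a \<le> r + r powr (1 - p) * a powr p" if "0 \<le> a" for a
    proof (cases "a \<le> r")
      case True
      then show ?thesis by (simp add: add_increasing2)
    next
      case False
      then have "r powr (1 - p) * a powr p \<ge> a powr (1 - p) * a powr p"
        using p r by (intro mult_right_mono powr_mono2') auto
      also have "a powr (1 - p) * a powr p = a" using False r by (simp flip: powr_add)
      finally show ?thesis using r by simp
    qed
    have "ennreal (cmod ?I) \<le> (\<integral>\<^sup>+ y. ennreal (cmod (u y) * w y) \<partial>M)"
    proof (cases "integrable M (\<lambda>y. u y * of_real (w y))")
      case True
      from integral_norm_bound_ennreal[OF True] show ?thesis
        using w by (simp add: norm_mult)
    qed (simp add: not_integrable_integral_eq)
    also have "\<dots> \<le> (\<integral>\<^sup>+ y. ennreal r * ennreal (w y) + ennreal (r powr (1 - p)) * ennreal (cmod (u y) powr p * w y) \<partial>M)"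
    proof (rule nn_integral_mono)
      fix y
      have "cmod (u y) * w y \<le> (r + r powr (1 - p) * cmod (u y) powr p) * w y"
        using pw w by (intro mult_right_mono) auto
      then show "ennreal (cmod (u y) * w y) \<le> ennreal r * ennreal (w y) + ennreal (r powr (1 - p)) * ennreal (cmod (u y) powr p * w y)"
        using w r by (simp flip: ennreal_plus ennreal_mult add: ennreal_leI algebra_simps)
    qed
    also have "\<dots> = ennreal r * 1 + ennreal (r powr (1 - p)) * ennreal t"
      unfolding w(2)[symmetric] real(2)[symmetric] by (simp add: nn_integral_add nn_integral_cmult)
    also have "\<dots> = ennreal (r + r powr (1 - p) * t)"
      using r real(1) by (simp flip: ennreal_mult)
    finally show ?thesis using r real(1) by (subst (asm) ennreal_le_iff) auto
  qed
  have "cmod ?I powr p \<le> 2 powr p * t"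
  proof (cases "t = 0")
    case True
    have "cmod ?I \<le> 0"
      by (rule field_le_epsilon) (use key True in auto)
    then show ?thesis using True by simp
  next
    case False
    then have t: "t > 0" using real by simp
    have "cmod ?I \<le> t powr (1 / p) + (t powr (1 / p)) powr (1 - p) * t"
      using t by (intro key) simp
    also have "(t powr (1 / p)) powr (1 - p) * t = t powr (1 / p * (1 - p) + 1)"
      using t by (simp add: powr_powr powr_add)
    also have "1 / p * (1 - p) + 1 = 1 / p" using p by (simp add: field_simps)
    finally have "cmod ?I \<le> 2 * t powr (1 / p)" by simp
    then have "cmod ?I powr p \<le> (2 * t powr (1 / p)) powr p"
      using p by (intro powr_mono2) auto
    also have "\<dots> = 2 powr p * t" using t p by (simp add: powr_mult powr_powr)
    finally show ?thesis .
  qed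
  then have "ennreal (cmod ?I powr p) \<le> ennreal (2 powr p * t)" by (rule ennreal_leI)
  then show ?thesis unfolding real(2) using real(1) by (simp add: ennreal_mult)
qed

context haar_group
begin

section \<open>Density of continuous functions of compact support in \<open>L\<^sup>p\<close>\<close>

definition Cc_approximable :: "real \<Rightarrow> ('a \<Rightarrow> complex) \<Rightarrow> bool" where
  "Cc_approximable p f \<longleftrightarrow> f \<in> borel_measurable borel \<and>
     (\<forall>e>0. \<exists>g. compactly_supported g \<and> (\<integral>\<^sup>+ x. ennreal (cmod (f x - g x) powr p) \<partial>\<mu>) \<le> ennreal e)"

lemma Cc_approximableI:
  assumes "f \<in> borel_measurable borel"
    "\<And>e. 0 < e \<Longrightarrow> \<exists>g. compactly_supported g \<and> (\<integral>\<^sup>+ x. ennreal (cmod (f x - g x) powr p) \<partial>\<mu>) \<le> ennreal e"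
  shows "Cc_approximable p f"
  using assms by (simp add: Cc_approximable_def)

lemma compactly_supported_add: "compactly_supported f \<Longrightarrow> compactly_supported g \<Longrightarrow> compactly_supported (\<lambda>x. f x + g x)"
  for f g :: "'a \<Rightarrow> complex"
proof -
  assume "compactly_supported f" "compactly_supported g"
  then obtain K L where K: "compact K" "\<And>x. x \<notin> K \<Longrightarrow> f x = 0" "compact L" "\<And>x. x \<notin> L \<Longrightarrow> g x = 0"
     "continuous_on UNIV f" "continuous_on UNIV g" by (auto simp: compactly_supported_def)
  then show ?thesis by (intro compactly_supportedI[of _ "K \<union> L"] continuous_intros) auto
qed

lemma Cc_approximable_add:
  assumes "Cc_approximable p f" "Cc_approximable p h" and p: "0 < p"
  shows "Cc_approximable p (\<lambda>x. f x + h x)"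
proof (rule Cc_approximableI)
  have [measurable]: "f \<in> borel_measurable borel" "h \<in> borel_measurable borel"
    using assms by (auto simp: Cc_approximable_def)
  show "(\<lambda>x. f x + h x) \<in> borel_measurable borel" by measurable
  fix e :: real assume e: "0 < e"
  define d where "d = e / (2 * 3 powr p)"
  have d: "0 < d" using e by (simp add: d_def)
  obtain g where g: "compactly_supported g" "(\<integral>\<^sup>+ x. ennreal (cmod (f x - g x) powr p) \<partial>\<mu>) \<le> ennreal d"
    using assms d unfolding Cc_approximable_def by blast
  obtain k where k: "compactly_supported k" "(\<integral>\<^sup>+ x. ennreal (cmod (h x - k x) powr p) \<partial>\<mu>) \<le> ennreal d"
    using assms d unfolding Cc_approximable_def by blast
  have [measurable]: "g \<in> borel_measurable borel" "k \<in> borel_measurable borel"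
    using g k by (auto intro: compactly_supported_measurable)
  have "(\<integral>\<^sup>+ x. ennreal (cmod (f x + h x - (g x + k x)) powr p) \<partial>\<mu>)
     = (\<integral>\<^sup>+ x. ennreal (cmod ((f x - g x) + (h x - k x) + 0) powr p) \<partial>\<mu>)"
    by (simp add: algebra_simps)
  also have "\<dots> \<le> ennreal (3 powr p) * ((\<integral>\<^sup>+ x. ennreal (cmod (f x - g x) powr p) \<partial>\<mu>)
      + (\<integral>\<^sup>+ x. ennreal (cmod (h x - k x) powr p) \<partial>\<mu>) + (\<integral>\<^sup>+ x. ennreal (cmod 0 powr p) \<partial>\<mu>))"
    using p by (intro nn_integral_powr_triangle3) auto
  also have "\<dots> \<le> ennreal (3 powr p) * (ennreal d + ennreal d + 0)"
    using g k p by (intro mult_left_mono add_mono) auto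
  also have "\<dots> = ennreal e" using d by (simp add: d_def flip: ennreal_plus ennreal_mult)
  finally show "\<exists>g. compactly_supported g \<and> (\<integral>\<^sup>+ x. ennreal (cmod (f x + h x - g x) powr p) \<partial>\<mu>) \<le> ennreal e"
    using compactly_supported_add[OF g(1) k(1)] by blast
qed

text \<open>
Squeeze \<open>A\<close> between a compact and an open set of nearly the same measure, and take a Urysohn function for
that pair. Since \<open>K\<close> need not lie in \<open>A\<close>, the error is carried by \<open>U - A\<close> and \<open>U - K\<close>.
\<close>

lemma Cc_approximable_indicator:
  assumes A: "A \<in> sets borel" "emeasure \<mu> A < \<infinity>" and p: "1 \<le> p"
  shows "Cc_approximable p (\<lambda>x. z * indicator A x)"
proof (cases "z = 0")
  case True
  have "compactly_supported (\<lambda>x::'a. 0 :: complex)" by (rule compactly_supportedI[of _ "{}"]) auto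
  with p show ?thesis unfolding True by (intro Cc_approximableI) (auto intro!: exI[of _ "\<lambda>_. 0"])
next
  case False
  show ?thesis
  proof (rule Cc_approximableI)
    have [measurable]: "A \<in> sets borel" by fact
    show "(\<lambda>x. z * indicator A x) \<in> borel_measurable borel" by measurable
    fix e :: real assume e: "0 < e"
    define d where "d = e / (2 * cmod z powr p)"
    have d: "0 < d" using e False by (simp add: d_def)
    have "(INF U\<in>{U. open U \<and> A \<subseteq> U}. emeasure \<mu> U) < emeasure \<mu> A + ennreal d"
      using A d unfolding emeasure_outer[OF A(1), symmetric]
      by (cases "emeasure \<mu> A") (auto simp flip: ennreal_plus simp: ennreal_less_iff)
    then obtain U where U: "open U" "A \<subseteq> U" "emeasure \<mu> U < emeasure \<mu> A + ennreal d"
      by (auto simp: INF_less_iff)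
    have Ufin: "emeasure \<mu> U < \<infinity>" using U A by (auto intro: less_trans)
    have "emeasure \<mu> U < (SUP K\<in>{K. compact K \<and> K \<subseteq> U}. emeasure \<mu> K + ennreal d)"
    proof -
      have "(SUP K\<in>{K. compact K \<and> K \<subseteq> U}. emeasure \<mu> K + ennreal d) = emeasure \<mu> U + ennreal d"
        unfolding emeasure_open[OF U(1)] by (rule ennreal_SUP_add_left) (auto intro: exI[of _ "{}"])
      then show ?thesis using Ufin d
        by (cases "emeasure \<mu> U") (auto simp flip: ennreal_plus simp: ennreal_less_iff)
    qed
    then obtain K where K: "compact K" "K \<subseteq> U" "emeasure \<mu> U < emeasure \<mu> K + ennreal d"
      by (auto simp: less_SUP_iff)
    have [measurable]: "U \<in> sets borel" "K \<in> sets borel" using U K by auto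
    have UA: "emeasure \<mu> (U - A) \<le> ennreal d"
    proof -
      have "emeasure \<mu> (U - A) = emeasure \<mu> U - emeasure \<mu> A"
        using U A by (intro emeasure_Diff) auto
      also have "\<dots> \<le> ennreal d" using U(3) A(2)
        by (intro ennreal_minus_le_iff[THEN iffD2]) (auto simp: add.commute)
      finally show ?thesis .
    qed
    have UK: "emeasure \<mu> (U - K) \<le> ennreal d"
    proof -
      have Kfin: "emeasure \<mu> K < \<infinity>" by (rule emeasure_compact[OF K(1)])
      then have "emeasure \<mu> (U - K) = emeasure \<mu> U - emeasure \<mu> K"
        using U K by (intro emeasure_Diff) auto
      also have "\<dots> \<le> ennreal d" using K(3) Kfin
        by (intro ennreal_minus_le_iff[THEN iffD2]) (auto simp: add.commute)
      finally show ?thesis .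
    qed
    obtain g :: "'a \<Rightarrow> real" where g: "compactly_supported g" "\<And>x. 0 \<le> g x" "\<And>x. g x \<le> 1"
      "\<And>x. x \<in> K \<Longrightarrow> g x = 1" "\<And>x. x \<notin> U \<Longrightarrow> g x = 0"
      using urysohn_compactly_supported[OF K(1) U(1) K(2)] by blast
    have [measurable]: "g \<in> borel_measurable borel" using g by (intro compactly_supported_measurable)
    have pw: "cmod (z * indicator A x - z * of_real (g x)) powr p \<le> cmod z powr p * (indicator (U - A) x + indicator (U - K) x)" for x
    proof -
      have "cmod (z * indicator A x - z * of_real (g x)) = cmod z * \<bar>indicator A x - g x\<bar>"
      proof -
        have "z * indicator A x - z * of_real (g x) = z * of_real (indicator A x - g x)"
          by (simp add: indicator_def algebra_simps)
        then show ?thesis by (simp only: norm_mult norm_of_real)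
      qed
      moreover have "\<bar>indicator A x - g x\<bar> powr p \<le> \<bar>indicator A x - g x\<bar> powr 1"
        using p g(2,3)[of x] by (intro powr_mono') (auto simp: indicator_def)
      moreover have "\<bar>indicator A x - g x\<bar> \<le> indicator (U - A) x + indicator (U - K) x"
        using g(2,3)[of x] g(4,5)[of x] U(2) K(2) by (auto simp: indicator_def)
      ultimately show ?thesis by (simp add: powr_mult mult_left_mono)
    qed
    have "(\<integral>\<^sup>+ x. ennreal (cmod (z * indicator A x - z * of_real (g x)) powr p) \<partial>\<mu>)
       \<le> (\<integral>\<^sup>+ x. ennreal (cmod z powr p) * (indicator (U - A) x + indicator (U - K) x) \<partial>\<mu>)"
    proof (rule nn_integral_mono)
      fix x
      have "ennreal (cmod (z * indicator A x - z * of_real (g x)) powr p) \<le> ennreal (cmod z powr p * (indicator (U - A) x + indicator (U - K) x))"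
        by (rule ennreal_leI[OF pw])
      also have "\<dots> = ennreal (cmod z powr p) * (indicator (U - A) x + indicator (U - K) x)"
        by (simp add: ennreal_mult ennreal_indicator)
      finally show "ennreal (cmod (z * indicator A x - z * of_real (g x)) powr p) \<le> \<dots>" .
    qed
    also have "\<dots> = ennreal (cmod z powr p) * (emeasure \<mu> (U - A) + emeasure \<mu> (U - K))"
      by (simp add: nn_integral_cmult nn_integral_add)
    also have "\<dots> \<le> ennreal (cmod z powr p) * (ennreal d + ennreal d)"
      using UA UK by (intro mult_left_mono add_mono) auto
    also have "\<dots> = ennreal e" using d False by (simp add: d_def flip: ennreal_plus ennreal_mult)
    finally have "(\<integral>\<^sup>+ x. ennreal (cmod (z * indicator A x - z * of_real (g x)) powr p) \<partial>\<mu>) \<le> ennreal e" .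
    moreover have "compactly_supported (\<lambda>x. z * of_real (g x))"
      using g(1) by (auto simp: compactly_supported_def intro!: continuous_intros)
    ultimately show "\<exists>g. compactly_supported g \<and> (\<integral>\<^sup>+ x. ennreal (cmod (z * indicator A x - g x) powr p) \<partial>\<mu>) \<le> ennreal e"
      by blast
  qed
qed

text \<open>
Each nonzero value is attained on a set of finite measure by Markov's inequality.
\<close>

lemma Cc_approximable_simple:
  assumes s: "simple_function \<mu> s" and fin: "(\<integral>\<^sup>+ x. ennreal (cmod (s x) powr p) \<partial>\<mu>) < \<infinity>" and p: "1 \<le> p"
  shows "Cc_approximable p s"
proof -
  have [measurable]: "s -` {z} \<in> sets borel" for z
    using simple_functionD(2)[OF s, of "{z}"] by simp
  have sm [measurable]: "s \<in> borel_measurable borel"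
    using borel_measurable_simple_function[OF s] by simp
  have piece: "Cc_approximable p (\<lambda>x. z * indicator (s -` {z}) x)" for z
  proof (cases "z = 0")
    case True
    then show ?thesis using Cc_approximable_indicator[of "{}" p 0] p by simp
  next
    case False
    have "ennreal (cmod z powr p) * emeasure \<mu> (s -` {z}) = (\<integral>\<^sup>+ x. ennreal (cmod z powr p) * indicator (s -` {z}) x \<partial>\<mu>)"
      by (simp add: nn_integral_cmult)
    also have "\<dots> \<le> (\<integral>\<^sup>+ x. ennreal (cmod (s x) powr p) \<partial>\<mu>)"
      by (intro nn_integral_mono) (auto simp: indicator_def)
    also have "\<dots> < \<infinity>" by fact
    finally have "emeasure \<mu> (s -` {z}) < \<infinity>"
      using False by (auto simp: ennreal_mult_less_top)
    then show ?thesis by (intro Cc_approximable_indicator p) auto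
  qed
  have "finite (range s)" using simple_functionD(1)[OF s] by simp
  have sum: "finite D \<Longrightarrow> Cc_approximable p (\<lambda>x. \<Sum>z\<in>D. z * indicator (s -` {z}) x)" for D
  proof (induction D rule: finite_induct)
    case empty
    then show ?case using Cc_approximable_indicator[of "{}" p 0] p by simp
  next
    case (insert z D)
    show ?case unfolding sum.insert[OF insert.hyps]
      by (rule Cc_approximable_add[OF piece insert.IH]) (use p in simp)
  qed
  have "s = (\<lambda>x. \<Sum>z\<in>range s. z * indicator (s -` {z}) x)"
  proof
    fix x
    have "(\<Sum>z\<in>range s. z * indicator (s -` {z}) x) = (\<Sum>z\<in>range s. if z = s x then z else 0)"
      by (intro sum.cong) (auto simp: indicator_def)
    then show "s x = (\<Sum>z\<in>range s. z * indicator (s -` {z}) x)"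
      using \<open>finite (range s)\<close> by simp
  qed
  then show ?thesis using sum[OF \<open>finite (range s)\<close>] by simp
qed

lemma Cc_approximable_of_Lp:
  assumes f [measurable]: "f \<in> borel_measurable borel"
    and fin: "(\<integral>\<^sup>+ x. ennreal (cmod (f x) powr p) \<partial>\<mu>) < \<infinity>" and p: "1 \<le> p"
  shows "Cc_approximable p f"
proof (rule Cc_approximableI[OF f])
  fix e :: real assume e: "0 < e"
  define d where "d = e / (2 * 3 powr p)"
  have d: "0 < d" using e by (simp add: d_def)
  have "f \<in> borel_measurable \<mu>" by simp
  from borel_measurable_implies_sequence_metric[OF this, of 0]
  obtain s where s: "\<And>i. simple_function \<mu> (s i)" "\<And>x. (\<lambda>i. s i x) \<longlonglongrightarrow> f x"
    "\<And>i x. cmod (s i x) \<le> 2 * cmod (f x)"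
    by auto
  have [measurable]: "s i \<in> borel_measurable borel" for i
    using borel_measurable_simple_function[OF s(1)] by simp
  have "(\<lambda>i. \<integral>\<^sup>+ x. ennreal (cmod (f x - s i x) powr p) \<partial>\<mu>) \<longlonglongrightarrow> (\<integral>\<^sup>+ x. 0 \<partial>\<mu>)"
  proof (rule nn_integral_dominated_convergence[where w = "\<lambda>x. ennreal (3 powr p) * ennreal (cmod (f x) powr p)"])
    show "(\<integral>\<^sup>+ x. ennreal (3 powr p) * ennreal (cmod (f x) powr p) \<partial>\<mu>) < \<infinity>"
      using fin by (simp add: nn_integral_cmult ennreal_mult_less_top)
    show "AE x in \<mu>. ennreal (cmod (f x - s i x) powr p) \<le> ennreal (3 powr p) * ennreal (cmod (f x) powr p)" for i
    proof (rule AE_I2)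
      fix x
      have "cmod (f x - s i x) \<le> 3 * cmod (f x)"
        using norm_triangle_ineq4[of "f x" "s i x"] s(3)[of i x] by linarith
      then have "cmod (f x - s i x) powr p \<le> (3 * cmod (f x)) powr p"
        using p by (intro powr_mono2) auto
      then show "ennreal (cmod (f x - s i x) powr p) \<le> ennreal (3 powr p) * ennreal (cmod (f x) powr p)"
        by (simp add: powr_mult ennreal_leI flip: ennreal_mult)
    qed
    show "AE x in \<mu>. (\<lambda>i. ennreal (cmod (f x - s i x) powr p)) \<longlonglongrightarrow> 0"
    proof (rule AE_I2)
      fix x
      have "(\<lambda>i. f x - s i x) \<longlonglongrightarrow> f x - f x" by (intro tendsto_intros s)
      then have "(\<lambda>i. cmod (f x - s i x) powr p) \<longlonglongrightarrow> 0"
        using p by (intro tendsto_zero_powrI[where b = p] tendsto_const) (auto intro: tendsto_norm_zero)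
      then show "(\<lambda>i. ennreal (cmod (f x - s i x) powr p)) \<longlonglongrightarrow> 0"
        by (metis ennreal_0 tendsto_ennrealI)
    qed
  qed auto
  then have "\<forall>\<^sub>F i in sequentially. (\<integral>\<^sup>+ x. ennreal (cmod (f x - s i x) powr p) \<partial>\<mu>) < ennreal d"
    using d by (intro order_tendstoD(2)) auto
  then obtain i where i: "(\<integral>\<^sup>+ x. ennreal (cmod (f x - s i x) powr p) \<partial>\<mu>) < ennreal d"
    by (auto simp: eventually_sequentially)
  have "(\<integral>\<^sup>+ x. ennreal (cmod (s i x) powr p) \<partial>\<mu>) \<le> (\<integral>\<^sup>+ x. ennreal (2 powr p) * ennreal (cmod (f x) powr p) \<partial>\<mu>)"
  proof (rule nn_integral_mono)
    fix x
    have "cmod (s i x) powr p \<le> (2 * cmod (f x)) powr p" using s p by (intro powr_mono2) auto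
    then show "ennreal (cmod (s i x) powr p) \<le> ennreal (2 powr p) * ennreal (cmod (f x) powr p)"
      by (simp add: powr_mult ennreal_leI flip: ennreal_mult)
  qed
  also have "\<dots> < \<infinity>" using fin by (simp add: nn_integral_cmult ennreal_mult_less_top)
  finally have "Cc_approximable p (s i)" by (rule Cc_approximable_simple[OF s(1) _ p])
  then obtain g where g: "compactly_supported g" "(\<integral>\<^sup>+ x. ennreal (cmod (s i x - g x) powr p) \<partial>\<mu>) \<le> ennreal d"
    using d unfolding Cc_approximable_def by blast
  have [measurable]: "g \<in> borel_measurable borel" using g by (intro compactly_supported_measurable)
  have "(\<integral>\<^sup>+ x. ennreal (cmod (f x - g x) powr p) \<partial>\<mu>)
     = (\<integral>\<^sup>+ x. ennreal (cmod ((f x - s i x) + (s i x - g x) + 0) powr p) \<partial>\<mu>)"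
    by (simp add: algebra_simps)
  also have "\<dots> \<le> ennreal (3 powr p) * ((\<integral>\<^sup>+ x. ennreal (cmod (f x - s i x) powr p) \<partial>\<mu>)
      + (\<integral>\<^sup>+ x. ennreal (cmod (s i x - g x) powr p) \<partial>\<mu>) + (\<integral>\<^sup>+ x. ennreal (cmod 0 powr p) \<partial>\<mu>))"
    using p by (intro nn_integral_powr_triangle3) auto
  also have "\<dots> \<le> ennreal (3 powr p) * (ennreal d + ennreal d + 0)"
    using g i p by (intro mult_left_mono add_mono) auto
  also have "\<dots> = ennreal e" using d by (simp add: d_def flip: ennreal_plus ennreal_mult)
  finally show "\<exists>g. compactly_supported g \<and> (\<integral>\<^sup>+ x. ennreal (cmod (f x - g x) powr p) \<partial>\<mu>) \<le> ennreal e"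
    using g(1) by blast
qed

section \<open>Convolution with an approximate identity\<close>

lemma borel_measurable_mu: "borel_measurable \<mu> = borel_measurable borel"
  by (rule measurable_cong_sets) simp_all

lemma convolve_eq_right_average:
  fixes \<psi> :: "'a \<Rightarrow> real"
  assumes [measurable]: "f \<in> borel_measurable borel" "\<psi> \<in> borel_measurable borel"
  shows "convolve \<mu> f (\<lambda>x. of_real (\<psi> (- x))) x = (\<integral>y. f (x + y) * of_real (\<psi> y) \<partial>\<mu>)"
proof -
  let ?h = "\<lambda>y. f y * complex_of_real (\<psi> (- x + y))"
  have "convolve \<mu> f (\<lambda>x. of_real (\<psi> (- x))) x = (\<integral>y. ?h y \<partial>\<mu>)"
    by (simp add: convolve_def minus_add)
  also have "\<dots> = (\<integral>y. ?h (x + y) \<partial>\<mu>)"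
    by (rule integral_left_translate[symmetric]) measurable
  finally show ?thesis by (simp flip: add.assoc)
qed

lemma continuous_on_convolve_compactly_supported:
  fixes \<psi> :: "'a \<Rightarrow> real" and g :: "'a \<Rightarrow> complex"
  assumes g: "compactly_supported g" and \<psi>: "compactly_supported \<psi>"
  shows "continuous_on UNIV (\<lambda>x. \<integral>y. g (x + y) * of_real (\<psi> y) \<partial>\<mu>)"
proof (rule continuous_on_param_integral)
  obtain S where S: "compact S" "\<And>y. y \<notin> S \<Longrightarrow> \<psi> y = 0" and cont: "continuous_on UNIV \<psi>" "continuous_on UNIV g"
    using g \<psi> by (auto simp: compactly_supported_def)
  show "continuous_on UNIV (\<lambda>(x, y). g (x + y) * of_real (\<psi> y))"
    unfolding split_def
    by (intro continuous_intros continuous_on_compose2[OF cont(1)] continuous_on_compose2[OF cont(2)]) auto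
  show "\<exists>W L. open W \<and> x0 \<in> W \<and> compact L \<and> (\<forall>x\<in>W. \<forall>y. y \<notin> L \<longrightarrow> g (x + y) * of_real (\<psi> y) = 0)" for x0
    using S by (intro exI[of _ UNIV] exI[of _ S]) auto
qed

text \<open>
The theorem for continuous functions of compact support: here the integrand
\<open>\<bar>g (x + y) - g x\<bar>\<^sup>p \<psi> y\<close> is itself continuous with compact support in \<open>(x, y)\<close>, so the integrals can be
exchanged.
\<close>

lemma convolve_compactly_supported_bound:
  fixes \<psi> :: "'a \<Rightarrow> real" and g :: "'a \<Rightarrow> complex"
  assumes g: "compactly_supported g" and \<psi>: "compactly_supported \<psi>" "\<And>y. 0 \<le> \<psi> y" "(\<integral>\<^sup>+ y. \<psi> y \<partial>\<mu>) = 1" and p: "1 \<le> p"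
    and M: "\<And>y. \<psi> y \<noteq> 0 \<Longrightarrow> (\<integral>\<^sup>+ x. ennreal (cmod (g (x + y) - g x) powr p) \<partial>\<mu>) \<le> M"
  shows "(\<integral>\<^sup>+ x. ennreal (cmod (convolve \<mu> g (\<lambda>x. of_real (\<psi> (- x))) x - g x) powr p) \<partial>\<mu>) \<le> ennreal (2 powr p) * M"
proof -
  obtain K where K: "compact K" "\<And>x. x \<notin> K \<Longrightarrow> g x = 0" and contg: "continuous_on UNIV g"
    using g by (auto simp: compactly_supported_def)
  obtain S where S: "compact S" "\<And>x. x \<notin> S \<Longrightarrow> \<psi> x = 0" and contp: "continuous_on UNIV \<psi>"
    using \<psi> by (auto simp: compactly_supported_def)
  have [measurable]: "g \<in> borel_measurable borel" "\<psi> \<in> borel_measurable borel"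
    using g \<psi> by (auto intro: compactly_supported_measurable)
  define F where "F x y = 2 powr p * (cmod (g (x + y) - g x) powr p * \<psi> y)" for x y
  have ccF: "compactly_supported (\<lambda>(x, y). F x y)"
  proof (rule compactly_supportedI)
    let ?C = "(K \<union> (\<lambda>(x, y). x + y) ` (K \<times> uminus ` S)) \<times> S"
    show "continuous_on UNIV (\<lambda>(x, y). F x y)"
      unfolding split_def F_def using p
      by (intro continuous_intros continuous_on_powr' continuous_on_compose2[OF contp]
          continuous_on_compose2[OF contg] ballI) auto
    show "compact ?C" using K S by (intro compact_Times compact_Un compact_plus compact_uminus)
    fix z assume z: "z \<notin> ?C"
    obtain x y where xy: "z = (x, y)" by (cases z)
    have "\<psi> y = 0 \<or> g (x + y) - g x = 0"
    proof (rule ccontr)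
      assume neg: "\<not> ?thesis"
      then have y: "y \<in> S" using S(2) by auto
      have "x \<in> K \<union> (\<lambda>(x, y). x + y) ` (K \<times> uminus ` S)"
      proof (cases "x \<in> K")
        case False
        then have "x + y \<in> K" using neg K(2) by force
        moreover have "x = (x + y) + - y" by (simp add: add.assoc)
        ultimately show ?thesis using y by (metis (mono_tags, lifting) SigmaI UnI2 case_prod_conv imageI)
      qed simp
      then show False using z xy y by blast
    qed
    then show "(\<lambda>(x, y). F x y) z = 0" using xy by (auto simp: F_def)
  qed
  have "(\<integral>\<^sup>+ x. ennreal (cmod (convolve \<mu> g (\<lambda>x. of_real (\<psi> (- x))) x - g x) powr p) \<partial>\<mu>)
     \<le> (\<integral>\<^sup>+ x. \<integral>\<^sup>+ y. F x y \<partial>\<mu> \<partial>\<mu>)"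
  proof (rule nn_integral_mono)
    fix x
    have "compactly_supported (\<lambda>y. g (x + y) * complex_of_real (\<psi> y))"
      using S by (intro compactly_supportedI[of _ S] continuous_intros continuous_on_compose2[OF contg] contp) auto
    then have i1: "integrable \<mu> (\<lambda>y. g (x + y) * complex_of_real (\<psi> y))" by (rule integrable_compactly_supported)
    have i2: "integrable \<mu> (\<lambda>y. g x * complex_of_real (\<psi> y))"
      using integrable_compactly_supported[OF \<psi>(1)] by (intro integrable_mult_right) simp
    have "(\<integral>y. \<psi> y \<partial>\<mu>) = 1"
      using \<psi>(3) nn_integral_compactly_supported[OF \<psi>(1,2)] \<psi>(2) by simp
    then have "(\<integral>y. g x * complex_of_real (\<psi> y) \<partial>\<mu>) = g x" by simp
    then have "convolve \<mu> g (\<lambda>x. of_real (\<psi> (- x))) x - g x = (\<integral>y. (g (x + y) - g x) * of_real (\<psi> y) \<partial>\<mu>)"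
      using Bochner_Integration.integral_diff[OF i1 i2]
      by (simp add: convolve_eq_right_average left_diff_distrib)
    moreover have "ennreal (cmod (\<integral>y. (g (x + y) - g x) * of_real (\<psi> y) \<partial>\<mu>) powr p)
        \<le> ennreal (2 powr p) * (\<integral>\<^sup>+ y. ennreal (cmod (g (x + y) - g x) powr p * \<psi> y) \<partial>\<mu>)"
      using \<psi> p by (intro powr_norm_average_le) auto
    moreover have "ennreal (2 powr p) * (\<integral>\<^sup>+ y. ennreal (cmod (g (x + y) - g x) powr p * \<psi> y) \<partial>\<mu>) = (\<integral>\<^sup>+ y. F x y \<partial>\<mu>)"
      using \<psi>(2) unfolding F_def by (subst nn_integral_cmult[symmetric]) (auto simp: ennreal_mult)
    ultimately show "ennreal (cmod (convolve \<mu> g (\<lambda>x. of_real (\<psi> (- x))) x - g x) powr p) \<le> (\<integral>\<^sup>+ y. F x y \<partial>\<mu>)"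
      by simp
  qed
  also have "\<dots> = (\<integral>\<^sup>+ y. \<integral>\<^sup>+ x. F x y \<partial>\<mu> \<partial>\<mu>)"
    using \<psi>(2) by (intro tonelli_compactly_supported ccF) (simp add: F_def)
  also have "\<dots> \<le> (\<integral>\<^sup>+ y. ennreal (2 powr p) * M * ennreal (\<psi> y) \<partial>\<mu>)"
  proof (rule nn_integral_mono)
    fix y
    have "(\<integral>\<^sup>+ x. F x y \<partial>\<mu>) = (\<integral>\<^sup>+ x. ennreal (2 powr p) * ennreal (\<psi> y) * ennreal (cmod (g (x + y) - g x) powr p) \<partial>\<mu>)"
      using \<psi>(2) by (intro nn_integral_cong) (simp add: F_def mult_ac flip: ennreal_mult)
    also have "\<dots> = ennreal (2 powr p) * ennreal (\<psi> y) * (\<integral>\<^sup>+ x. ennreal (cmod (g (x + y) - g x) powr p) \<partial>\<mu>)"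
      by (rule nn_integral_cmult) measurable
    also have "\<dots> \<le> ennreal (2 powr p) * ennreal (\<psi> y) * M"
      using M[of y] by (cases "\<psi> y = 0") (auto intro: mult_left_mono)
    finally show "(\<integral>\<^sup>+ x. F x y \<partial>\<mu>) \<le> ennreal (2 powr p) * M * ennreal (\<psi> y)"
      by (simp add: mult_ac)
  qed
  also have "\<dots> = ennreal (2 powr p) * M"
    using \<psi>(3) by (simp add: nn_integral_cmult)
  finally show ?thesis .
qed

text \<open>
A pointwise estimate whose right side is independent of \<open>x\<close>; it makes \<open>g\<^sub>n \<star> \<phi>\<close> converge everywhere to
\<open>f \<star> \<phi>\<close> when \<open>g\<^sub>n\<close> converges to \<open>f\<close> in \<open>L\<^sup>p\<close>. As a by-product \<open>f \<star> \<phi>\<close> is Borel.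
\<close>

lemma convolve_diff_bound:
  fixes \<psi> :: "'a \<Rightarrow> real" and f g :: "'a \<Rightarrow> complex"
  assumes [measurable]: "f \<in> borel_measurable borel" "g \<in> borel_measurable borel" "\<psi> \<in> borel_measurable borel"
    and int: "integrable \<mu> (\<lambda>y. f (x + y) * complex_of_real (\<psi> y))" "integrable \<mu> (\<lambda>y. g (x + y) * complex_of_real (\<psi> y))"
    and \<psi>: "\<And>y. 0 \<le> \<psi> y" "\<And>y. \<psi> y \<le> B" "(\<integral>\<^sup>+ y. \<psi> y \<partial>\<mu>) = 1" and p: "1 \<le> p"
  shows "ennreal (cmod (convolve \<mu> f (\<lambda>x. of_real (\<psi> (- x))) x - convolve \<mu> g (\<lambda>x. of_real (\<psi> (- x))) x) powr p)
     \<le> ennreal (2 powr p * B) * (\<integral>\<^sup>+ y. ennreal (cmod (f y - g y) powr p) \<partial>\<mu>)"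
proof -
  have B: "0 \<le> B" using \<psi>(1,2)[of 0] by linarith
  have "convolve \<mu> f (\<lambda>x. of_real (\<psi> (- x))) x - convolve \<mu> g (\<lambda>x. of_real (\<psi> (- x))) x
      = (\<integral>y. (f (x + y) - g (x + y)) * of_real (\<psi> y) \<partial>\<mu>)"
    using Bochner_Integration.integral_diff[OF int]
    by (simp add: convolve_eq_right_average left_diff_distrib)
  moreover have "ennreal (cmod (\<integral>y. (f (x + y) - g (x + y)) * of_real (\<psi> y) \<partial>\<mu>) powr p)
     \<le> ennreal (2 powr p) * (\<integral>\<^sup>+ y. ennreal (cmod (f (x + y) - g (x + y)) powr p * \<psi> y) \<partial>\<mu>)"
    using \<psi> p by (intro powr_norm_average_le) auto
  moreover have "(\<integral>\<^sup>+ y. ennreal (cmod (f (x + y) - g (x + y)) powr p * \<psi> y) \<partial>\<mu>)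
     \<le> (\<integral>\<^sup>+ y. ennreal B * ennreal (cmod (f (x + y) - g (x + y)) powr p) \<partial>\<mu>)"
    using \<psi> B by (intro nn_integral_mono) (simp add: ennreal_leI mult_right_mono mult.commute[of _ "\<psi> _"] flip: ennreal_mult)
  moreover have "\<dots> = ennreal B * (\<integral>\<^sup>+ y. ennreal (cmod (f (x + y) - g (x + y)) powr p) \<partial>\<mu>)"
    by (rule nn_integral_cmult) measurable
  moreover have "(\<integral>\<^sup>+ y. ennreal (cmod (f (x + y) - g (x + y)) powr p) \<partial>\<mu>) = (\<integral>\<^sup>+ y. ennreal (cmod (f y - g y) powr p) \<partial>\<mu>)"
    by (rule nn_integral_left_translate[of "\<lambda>y. ennreal (cmod (f y - g y) powr p)"]) measurable
  ultimately show ?thesis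
    using B by (simp add: ennreal_mult mult.assoc) (meson dual_order.trans mult_left_mono zero_le)
qed

lemma Lp_norm_le_iff:
  assumes "0 < p" "0 \<le> d"
  shows "Lp_norm \<mu> p f \<le> ennreal d \<longleftrightarrow> (\<integral>\<^sup>+ x. ennreal (cmod (f x) powr p) \<partial>\<mu>) \<le> ennreal (d powr p)"
proof (cases "(\<integral>\<^sup>+ x. ennreal (cmod (f x) powr p) \<partial>\<mu>)" rule: ennreal_cases)
  case (real t)
  have "t powr (1 / p) \<le> d \<longleftrightarrow> t \<le> d powr p"
  proof
    assume "t powr (1 / p) \<le> d"
    then have "(t powr (1 / p)) powr p \<le> d powr p" using assms by (intro powr_mono2) auto
    then show "t \<le> d powr p" using assms real by (simp add: powr_powr)
  next
    assume "t \<le> d powr p"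
    then have "t powr (1 / p) \<le> (d powr p) powr (1 / p)" using assms real by (intro powr_mono2) auto
    then show "t powr (1 / p) \<le> d" using assms by (simp add: powr_powr)
  qed
  then show ?thesis using real assms by (simp add: Lp_norm_def)
qed (simp add: Lp_norm_def top_unique)

text \<open>
The approximation argument. The factor \<open>6\<^sup>p = 2\<^sup>p 3\<^sup>p\<close> combines the losses in \<open>powr_norm_average_le\<close> and
\<open>nn_integral_powr_triangle3\<close>; the errors caused by replacing \<open>f\<close> by \<open>g\<^sub>n\<close> are multiples of \<open>2\<^sup>-\<^sup>n\<close> and
vanish in the limit.
\<close>

lemma convolve_near_identity:
  fixes \<psi> :: "'a \<Rightarrow> real" and f :: "'a \<Rightarrow> complex"
  assumes f: "f \<in> Lp_space \<mu> p" and p: "1 \<le> p"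
    and \<psi>: "compactly_supported \<psi>" "\<And>y. 0 \<le> \<psi> y" "(\<integral>\<^sup>+ y. \<psi> y \<partial>\<mu>) = 1"
    and e: "0 \<le> e" "\<And>y. \<psi> y \<noteq> 0 \<Longrightarrow> (\<integral>\<^sup>+ x. ennreal (cmod (f (x + y) - f x) powr p) \<partial>\<mu>) \<le> ennreal e"
  defines "C \<equiv> convolve \<mu> f (\<lambda>x. of_real (\<psi> (- x)))"
  shows "C \<in> borel_measurable borel"
    and "(\<integral>\<^sup>+ x. ennreal (cmod (C x - f x) powr p) \<partial>\<mu>) \<le> ennreal (6 powr p * e)"
proof -
  have fm [measurable]: "f \<in> borel_measurable borel" using f by (simp add: Lp_space_def borel_measurable_mu)
  have [measurable]: "\<psi> \<in> borel_measurable borel" using \<psi> by (intro compactly_supported_measurable)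
  have fin: "(\<integral>\<^sup>+ x. ennreal (cmod (f x) powr p) \<partial>\<mu>) < \<infinity>"
    using f by (auto simp: Lp_space_def Lp_norm_def Let_def top.not_eq_extremum split: if_splits)
  obtain S where S: "compact S" "\<And>x. x \<notin> S \<Longrightarrow> \<psi> x = 0" and contp: "continuous_on UNIV \<psi>"
    using \<psi> by (auto simp: compactly_supported_def)
  have "compact (\<psi> ` S)"
    using S contp by (meson compact_continuous_image continuous_on_subset top_greatest)
  then obtain B where B0: "\<And>k. k \<in> S \<Longrightarrow> norm (\<psi> k) \<le> B" and "B > 0"
    by (metis bounded_pos compact_imp_bounded imageI)
  have B: "\<psi> y \<le> B" for y using B0[of y] S(2)[of y] \<open>B > 0\<close> by (cases "y \<in> S") auto
  obtain c where c: "0 < c" "\<And>y (h::'a \<Rightarrow> ennreal). y \<in> S \<Longrightarrow> h \<in> borel_measurable borel \<Longrightarrow>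
       (\<integral>\<^sup>+ x. h (x + y) \<partial>\<mu>) \<le> ennreal c * (\<integral>\<^sup>+ x. h x \<partial>\<mu>)"
    using right_translate_bound[OF S(1)] by blast
  have "\<exists>g. compactly_supported g \<and> (\<integral>\<^sup>+ x. ennreal (cmod (f x - g x) powr p) \<partial>\<mu>) \<le> ennreal ((1 / 2) ^ n)" for n
    using Cc_approximable_of_Lp[OF fm fin p] unfolding Cc_approximable_def by simp
  then obtain g where g: "\<And>n. compactly_supported (g n)"
    and gf: "\<And>n. (\<integral>\<^sup>+ x. ennreal (cmod (f x - g n x) powr p) \<partial>\<mu>) \<le> ennreal ((1 / 2) ^ n)"
    by metis
  have gm [measurable]: "g n \<in> borel_measurable borel" for n using g by (intro compactly_supported_measurable)
  define G where "G n = convolve \<mu> (g n) (\<lambda>x. of_real (\<psi> (- x)))" for n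
  have "continuous_on UNIV (G n)" for n
  proof -
    have "G n = (\<lambda>x. \<integral>y. g n (x + y) * complex_of_real (\<psi> y) \<partial>\<mu>)"
      unfolding G_def by (rule ext, rule convolve_eq_right_average) measurable
    then show ?thesis using continuous_on_convolve_compactly_supported[OF g \<psi>(1), of n] by simp
  qed
  then have Gm [measurable]: "G n \<in> borel_measurable borel" for n by (rule borel_measurable_continuous_onI)
  have GC: "(\<lambda>n. G n x) \<longlonglongrightarrow> C x" for x
  proof -
    have "compactly_supported (\<lambda>x. complex_of_real (\<psi> (- x)))"
      using compactly_supported_inverse[OF \<psi>(1)] by (auto simp: compactly_supported_def intro: continuous_intros)
    from integrable_convolve_integrand[OF haar p f compactly_supported_in_Cc[OF this], of x]
    have "integrable (distr \<mu> borel (\<lambda>y. x + y)) (\<lambda>y. f y * complex_of_real (\<psi> (- x + y)))"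
      by (simp add: minus_add distr_left_translate)
    then have i1: "integrable \<mu> (\<lambda>y. f (x + y) * complex_of_real (\<psi> y))"
      by (subst (asm) integrable_distr_eq) (simp_all flip: add.assoc)
    have "compactly_supported (\<lambda>y. g n (x + y) * complex_of_real (\<psi> y))" for n
    proof -
      have contg: "continuous_on UNIV (g n)" using g by (simp add: compactly_supported_def)
      show ?thesis using S
        by (intro compactly_supportedI[of _ S] continuous_intros continuous_on_compose2[OF contg] contp) auto
    qed
    then have i2: "integrable \<mu> (\<lambda>y. g n (x + y) * complex_of_real (\<psi> y))" for n by (rule integrable_compactly_supported)
    have bound: "cmod (G n x - C x) \<le> (2 powr p * B * (1 / 2) ^ n) powr (1 / p)" for n
    proof -
      have "ennreal (cmod (C x - G n x) powr p) \<le> ennreal (2 powr p * B) * (\<integral>\<^sup>+ y. ennreal (cmod (f y - g n y) powr p) \<partial>\<mu>)"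
        unfolding C_def G_def using \<psi> B p i1 i2 by (intro convolve_diff_bound) auto
      also have "\<dots> \<le> ennreal (2 powr p * B) * ennreal ((1 / 2) ^ n)"
        using gf by (intro mult_left_mono) auto
      also have "\<dots> = ennreal (2 powr p * B * (1 / 2) ^ n)"
        using \<open>B > 0\<close> by (intro ennreal_mult[symmetric]) auto
      finally have "cmod (C x - G n x) powr p \<le> 2 powr p * B * (1 / 2) ^ n"
        using \<open>B > 0\<close> by (subst (asm) ennreal_le_iff) auto
      then have "(cmod (C x - G n x) powr p) powr (1 / p) \<le> (2 powr p * B * (1 / 2) ^ n) powr (1 / p)"
        using p by (intro powr_mono2) auto
      then show ?thesis using p by (simp add: powr_powr norm_minus_commute)
    qed
    have "(\<lambda>n. 2 powr p * B * (1 / 2) ^ n) \<longlonglongrightarrow> 0"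
      by (intro tendsto_mult_right_zero LIMSEQ_realpow_zero) auto
    then have "(\<lambda>n. (2 powr p * B * (1 / 2) ^ n) powr (1 / p)) \<longlonglongrightarrow> 0"
      using p \<open>B > 0\<close> by (intro tendsto_zero_powrI[OF _ tendsto_const]) auto
    from Lim_null_comparison[OF always_eventually[OF allI[OF bound]] this]
    have "(\<lambda>n. G n x - C x) \<longlonglongrightarrow> 0" .
    then show ?thesis by (simp add: LIM_zero_iff)
  qed
  show Cm [measurable]: "C \<in> borel_measurable borel"
    by (rule borel_measurable_LIMSEQ_metric[OF Gm GC])
  \<comment> \<open>The approximation is so fast that the errors are summable; hence convergence holds almost everywhere without passing to a subsequence.\<close>
  have AE: "AE x in \<mu>. (\<lambda>n. g n x) \<longlonglongrightarrow> f x"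
  proof -
    have "(\<integral>\<^sup>+ x. (\<Sum>n. ennreal (cmod (f x - g n x) powr p)) \<partial>\<mu>) = (\<Sum>n. \<integral>\<^sup>+ x. ennreal (cmod (f x - g n x) powr p) \<partial>\<mu>)"
      by (rule nn_integral_suminf) measurable
    also have "\<dots> \<le> (\<Sum>n. ennreal ((1 / 2) ^ n))"
      by (intro suminf_le gf) auto
    also have "\<dots> < \<infinity>"
      by (subst suminf_ennreal2) auto
    finally have "AE x in \<mu>. (\<Sum>n. ennreal (cmod (f x - g n x) powr p)) \<noteq> \<infinity>"
      by (intro nn_integral_PInf_AE) auto
    then show ?thesis
    proof eventually_elim
      case (elim x)
      then have "summable (\<lambda>n. cmod (f x - g n x) powr p)"
        by (intro summable_suminf_not_top) auto
      from summable_LIMSEQ_zero[OF this]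
      have "(\<lambda>n. (cmod (f x - g n x) powr p) powr (1 / p)) \<longlonglongrightarrow> 0"
        by (rule tendsto_zero_powrI[OF _ tendsto_const]) (use p in auto)
      moreover have "(a powr p) powr (1 / p) = a" if "0 \<le> a" for a
        using that p by (simp add: powr_powr)
      ultimately have "(\<lambda>n. norm (f x - g n x)) \<longlonglongrightarrow> 0" by (simp only: norm_ge_zero)
      from tendsto_diff[OF tendsto_const[of "f x"] tendsto_norm_zero_cancel[OF this]]
      show ?case by simp
    qed
  qed
  have bound: "(\<integral>\<^sup>+ x. ennreal (cmod (G n x - g n x) powr p) \<partial>\<mu>)
      \<le> ennreal (2 powr p * (3 powr p * (e + c * (1 / 2) ^ n + (1 / 2) ^ n)))" for n
  proof -
    let ?M = "ennreal (3 powr p) * (ennreal e + ennreal c * ennreal ((1 / 2) ^ n) + ennreal ((1 / 2) ^ n))"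
    have "(\<integral>\<^sup>+ x. ennreal (cmod (g n (x + y) - g n x) powr p) \<partial>\<mu>) \<le> ?M" if y: "\<psi> y \<noteq> 0" for y
    proof -
      \<comment> \<open>The modular bound controls the right translate of the error.\<close>
      have "(\<integral>\<^sup>+ x. ennreal (cmod (g n (x + y) - f (x + y)) powr p) \<partial>\<mu>)
         \<le> ennreal c * (\<integral>\<^sup>+ x. ennreal (cmod (g n x - f x) powr p) \<partial>\<mu>)"
        using S(2) y by (intro c(2)[of y "\<lambda>x. ennreal (cmod (g n x - f x) powr p)"]) auto
      also have "\<dots> \<le> ennreal c * ennreal ((1 / 2) ^ n)"
        using gf by (intro mult_left_mono) (simp_all add: norm_minus_commute)
      finally have t: "(\<integral>\<^sup>+ x. ennreal (cmod (g n (x + y) - f (x + y)) powr p) \<partial>\<mu>) \<le> ennreal c * ennreal ((1 / 2) ^ n)" .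
      have "(\<integral>\<^sup>+ x. ennreal (cmod (g n (x + y) - g n x) powr p) \<partial>\<mu>)
         = (\<integral>\<^sup>+ x. ennreal (cmod ((f (x + y) - f x) + (g n (x + y) - f (x + y)) + (f x - g n x)) powr p) \<partial>\<mu>)"
        by (simp add: algebra_simps)
      also have "\<dots> \<le> ennreal (3 powr p) * ((\<integral>\<^sup>+ x. ennreal (cmod (f (x + y) - f x) powr p) \<partial>\<mu>)
          + (\<integral>\<^sup>+ x. ennreal (cmod (g n (x + y) - f (x + y)) powr p) \<partial>\<mu>) + (\<integral>\<^sup>+ x. ennreal (cmod (f x - g n x) powr p) \<partial>\<mu>))"
        using p by (intro nn_integral_powr_triangle3) auto
      also have "\<dots> \<le> ?M" using e(2)[OF y] t gf by (intro mult_left_mono add_mono) auto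
      finally show ?thesis .
    qed
    then have "(\<integral>\<^sup>+ x. ennreal (cmod (G n x - g n x) powr p) \<partial>\<mu>) \<le> ennreal (2 powr p) * ?M"
      unfolding G_def by (intro convolve_compactly_supported_bound g \<psi> p)
    then show ?thesis using e(1) c(1) by (simp flip: ennreal_plus ennreal_mult)
  qed
  have "(\<integral>\<^sup>+ x. ennreal (cmod (C x - f x) powr p) \<partial>\<mu>) = (\<integral>\<^sup>+ x. liminf (\<lambda>n. ennreal (cmod (G n x - g n x) powr p)) \<partial>\<mu>)"
  proof (rule nn_integral_cong_AE)
    show "AE x in \<mu>. ennreal (cmod (C x - f x) powr p) = liminf (\<lambda>n. ennreal (cmod (G n x - g n x) powr p))"
      using AE
    proof eventually_elim
      case (elim x)
      have "(\<lambda>n. ennreal (cmod (G n x - g n x) powr p)) \<longlonglongrightarrow> ennreal (cmod (C x - f x) powr p)"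
        using p by (intro tendsto_ennrealI tendsto_powr' tendsto_norm tendsto_diff GC elim tendsto_const) auto
      then show ?case by (metis lim_imp_Liminf trivial_limit_sequentially)
    qed
  qed
  also have "\<dots> \<le> liminf (\<lambda>n. \<integral>\<^sup>+ x. ennreal (cmod (G n x - g n x) powr p) \<partial>\<mu>)"
    by (rule nn_integral_liminf) measurable
  also have "\<dots> \<le> liminf (\<lambda>n. ennreal (2 powr p * (3 powr p * (e + c * (1 / 2) ^ n + (1 / 2) ^ n))))"
    by (intro Liminf_mono always_eventually allI bound)
  also have "\<dots> = ennreal (2 powr p * (3 powr p * (e + c * 0 + 0)))"
    by (intro lim_imp_Liminf tendsto_ennrealI tendsto_intros LIMSEQ_realpow_zero) auto
  also have "\<dots> = ennreal (6 powr p * e)"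
    by (simp flip: mult.assoc powr_mult)
  finally show "(\<integral>\<^sup>+ x. ennreal (cmod (C x - f x) powr p) \<partial>\<mu>) \<le> ennreal (6 powr p * e)" .
qed

end

theorem theorem11:
  fixes \<mu> :: "'a::{topological_group_add, t2_space} measure"
    and p :: real
    and F :: "('a \<Rightarrow> complex) set"
  assumes "locally_compact_space (euclidean :: 'a topology)"
    and "left_haar_measure \<mu>"
    and "1 \<le> p"
    and "F \<subseteq> Lp_space \<mu> p"
    and "Lp_equicontinuous \<mu> p F"
  shows "\<forall>\<epsilon>::real. \<epsilon> > 0 \<longrightarrow>
           (\<exists>\<phi>\<in>Cc. \<forall>f\<in>F. (\<lambda>x. convolve \<mu> f \<phi> x - f x) \<in> Lp_space \<mu> p \<and>
                             Lp_norm \<mu> p (\<lambda>x. convolve \<mu> f \<phi> x - f x) \<le> ennreal \<epsilon>)"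
proof (intro allI impI)
  fix \<epsilon> :: real assume \<epsilon>: "\<epsilon> > 0"
  interpret haar_group \<mu> by unfold_locales (rule assms)+
  have p: "0 < p" using assms(3) by simp
  have "0 < \<epsilon> / 6" using \<epsilon> by simp
  then obtain U where U: "open U" "0 \<in> U"
    and "\<forall>f\<in>F. (SUP x\<in>U. Lp_norm \<mu> p (\<lambda>y. left_translate x f y - f y)) \<le> ennreal (\<epsilon> / 6) \<and>
               (SUP x\<in>U. Lp_norm \<mu> p (\<lambda>y. right_translate x f y - f y)) \<le> ennreal (\<epsilon> / 6)"
    using assms(5) unfolding Lp_equicontinuous_def by blast
  then have eq: "(\<integral>\<^sup>+ x. ennreal (cmod (f (x + y) - f x) powr p) \<partial>\<mu>) \<le> ennreal ((\<epsilon> / 6) powr p)"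
    if "f \<in> F" "y \<in> U" for f y
    using that \<epsilon> p by (simp add: Lp_norm_le_iff[symmetric] SUP_le_iff right_translate_def)
  obtain q :: "'a \<Rightarrow> real" where q: "compactly_supported q" "\<And>x. 0 \<le> q x" "\<And>x. q x \<le> 1"
      "\<And>x. x \<in> {0} \<Longrightarrow> q x = 1" "\<And>x. x \<notin> U \<Longrightarrow> q x = 0"
    by (rule urysohn_compactly_supported[of "{0}" U]) (use U in auto)
  define I where "I = (\<integral>x. q x \<partial>\<mu>)"
  have I: "0 < I" unfolding I_def using q by (intro integral_compactly_supported_pos[of q 0]) auto
  define \<psi> where "\<psi> x = q x / I" for x
  have \<psi>: "compactly_supported \<psi>" "\<And>y. 0 \<le> \<psi> y"
    using q I by (auto simp: compactly_supported_def \<psi>_def[abs_def] intro!: continuous_intros)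
  have "(\<integral>\<^sup>+ y. \<psi> y \<partial>\<mu>) = ennreal (\<integral>y. \<psi> y \<partial>\<mu>)" by (rule nn_integral_compactly_supported[OF \<psi>])
  also have "(\<integral>y. \<psi> y \<partial>\<mu>) = 1" using I by (simp add: \<psi>_def I_def)
  finally have \<psi>1: "(\<integral>\<^sup>+ y. \<psi> y \<partial>\<mu>) = 1" by simp
  have supp: "y \<in> U" if "\<psi> y \<noteq> 0" for y using that q(5)[of y] by (auto simp: \<psi>_def)
  let ?\<phi> = "\<lambda>x. complex_of_real (\<psi> (- x))"
  have "compactly_supported ?\<phi>"
    using compactly_supported_inverse[OF \<psi>(1)] by (auto simp: compactly_supported_def intro: continuous_intros)
  then have "?\<phi> \<in> Cc" by (rule compactly_supported_in_Cc)
  moreover have "(\<lambda>x. convolve \<mu> f ?\<phi> x - f x) \<in> Lp_space \<mu> p \<and>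
     Lp_norm \<mu> p (\<lambda>x. convolve \<mu> f ?\<phi> x - f x) \<le> ennreal \<epsilon>" if f: "f \<in> F" for f
  proof -
    have fL: "f \<in> Lp_space \<mu> p" using f assms(4) by blast
    have m: "f \<in> borel_measurable borel" using fL by (simp add: Lp_space_def borel_measurable_mu)
    note * = convolve_near_identity[OF fL assms(3) \<psi> \<psi>1 _ eq[OF f supp]]
    have "(\<integral>\<^sup>+ x. ennreal (cmod (convolve \<mu> f ?\<phi> x - f x) powr p) \<partial>\<mu>) \<le> ennreal (6 powr p * (\<epsilon> / 6) powr p)"
      by (rule *(2)) simp_all
    also have "6 powr p * (\<epsilon> / 6) powr p = \<epsilon> powr p" using \<epsilon> by (simp flip: powr_mult)
    finally have le: "Lp_norm \<mu> p (\<lambda>x. convolve \<mu> f ?\<phi> x - f x) \<le> ennreal \<epsilon>"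
      using \<epsilon> p by (simp add: Lp_norm_le_iff)
    moreover have "convolve \<mu> f ?\<phi> \<in> borel_measurable borel" by (rule *(1)) simp_all
    ultimately show ?thesis
      using m by (auto simp: Lp_space_def intro: le_less_trans)
  qed
  ultimately show "\<exists>\<phi>\<in>Cc. \<forall>f\<in>F. (\<lambda>x. convolve \<mu> f \<phi> x - f x) \<in> Lp_space \<mu> p \<and>
     Lp_norm \<mu> p (\<lambda>x. convolve \<mu> f \<phi> x - f x) \<le> ennreal \<epsilon>"
    by blast
qed

end
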